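(* Let $\mathcal{F}_t$ be a smooth $1$-parameter family of transversely oriented codimension one foliations on a smooth manifold $M$. (1) If $\mathcal{F}_t$ can be defined by a $1$-form $\alpha$ (depending on $t$) for which $\beta$ or $\gamma$ or $\delta$ vanishes (i.e. can be chosen to be identically zero), then $TGV(\mathcal{F}_t)=0$. (2) If $\mathcal{F}_t$ can be defined by a $1$-form $\alpha$ (depending on $t$) such that $\alpha$ or $\beta$ or $\gamma$ or $\delta$ is closed (for $\beta,\gamma,\delta$: can be chosen to be closed), then $TGV(\mathcal{F}_t)=0$. Here $\beta,\gamma,\delta$ are $1$-forms associated with $\alpha$ by the structure equations $d\alpha=\alpha\wedge\beta$, $d\beta=\alpha\wedge\gamma$, $d\gamma=\beta\wedge\gamma+\alpha\wedge\delta$.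
   Context: All manifolds, foliations, forms and families are of class $C^\infty$. For a $1$-parameter family all forms depend smoothly on $t$, $d$ is the exterior derivative on $M$, and a dot denotes the derivative with respect to $t$. A defining form of a transversely oriented codimension one foliation $\mathcal{F}$ is a nowhere vanishing $1$-form $\alpha$ with $\ker\alpha=T\mathcal{F}$, positive on positively oriented transversals. Given $\alpha$, there exists a $1$-form $\beta$ with $d\alpha=\alpha\wedge\beta$; given $\alpha,\beta$ there exists a $1$-form $\gamma$ with $d\beta=\alpha\wedge\gamma$; given these there exists a $1$-form $\delta$ with $d\gamma=\beta\wedge\gamma+\alpha\wedge\delta$; and then $d\delta=2\beta\wedge\delta+\alpha\wedge\epsilon$ for some $1$-form $\epsilon$. The forms $\beta,\gamma,\delta,\epsilon$ are not unique. The form $(\dot\beta\wedge\beta\wedge d\beta)(t)$ is closed and its class $TGV(\mathcal{F}_t)=[(\dot\beta\wedge\beta\wedge d\beta)(t)]\in H^4(M,\mathbb{R})$ is independent of the choices of $\alpha$ and $\beta$. *)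

theory Defs
  imports "HOL-Analysis.Analysis"
begin

section \<open>Smooth maps between open subsets of normed spaces\<close>

text \<open>These predicates are only meant for open \<open>S\<close>; the derivative is the two-sided one.\<close>

primrec Ck_on :: "nat \<Rightarrow> 'a::real_normed_vector set \<Rightarrow> ('a \<Rightarrow> 'b::real_normed_vector) \<Rightarrow> bool" where
  "Ck_on 0 S f \<longleftrightarrow> continuous_on S f"
| "Ck_on (Suc k) S f \<longleftrightarrow>
     (\<forall>x\<in>S. f differentiable (at x)) \<and> (\<forall>v. Ck_on k S (\<lambda>x. frechet_derivative f (at x) v))"

definition smooth_on :: "'a::real_normed_vector set \<Rightarrow> ('a \<Rightarrow> 'b::real_normed_vector) \<Rightarrow> bool" where
  "smooth_on S f \<longleftrightarrow> (\<forall>k. Ck_on k S f)"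


section \<open>Smooth manifolds\<close>

text \<open>A chart is a pair of an open domain and a coordinate map; the values of the map outside
  the domain are irrelevant.\<close>

type_synonym ('a, 'e) chart = "'a set \<times> ('a \<Rightarrow> 'e)"

definition chart_img :: "('a, 'e) chart \<Rightarrow> 'e set" where
  "chart_img c = snd c ` fst c"

definition chart_overlap :: "('a, 'e) chart \<Rightarrow> ('a, 'e) chart \<Rightarrow> 'e set" where
  "chart_overlap c c' = snd c ` (fst c \<inter> fst c')"

definition transition :: "('a, 'e) chart \<Rightarrow> ('a, 'e) chart \<Rightarrow> 'e \<Rightarrow> 'e" where
  "transition c c' = snd c' \<circ> inv_into (fst c) (snd c)"

definition is_chart :: "'a topology \<Rightarrow> ('a, 'e::euclidean_space) chart \<Rightarrow> bool" where
  "is_chart X c \<longleftrightarrow> openin X (fst c) \<and> open (chart_img c) \<and>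
     homeomorphic_map (subtopology X (fst c)) (top_of_set (chart_img c)) (snd c)"

definition smoothly_compatible ::
    "('a, 'e::euclidean_space) chart \<Rightarrow> ('a, 'e) chart \<Rightarrow> bool" where
  "smoothly_compatible c c' \<longleftrightarrow>
     smooth_on (chart_overlap c c') (transition c c') \<and>
     smooth_on (chart_overlap c' c) (transition c' c)"

text \<open>The smooth structure \<open>A\<close> is a maximal smooth atlas on the Hausdorff, second countable
  space \<open>X\<close>; the dimension is \<open>DIM('e)\<close>.\<close>

definition smooth_manifold :: "'a topology \<Rightarrow> ('a, 'e::euclidean_space) chart set \<Rightarrow> bool" where
  "smooth_manifold X A \<longleftrightarrow>
     Hausdorff_space X \<and> second_countable X \<and>
     (\<forall>c\<in>A. is_chart X c) \<and>
     (\<Union>c\<in>A. fst c) = topspace X \<and>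
     (\<forall>c\<in>A. \<forall>c'\<in>A. smoothly_compatible c c') \<and>
     (\<forall>c. is_chart X c \<and> (\<forall>c'\<in>A. smoothly_compatible c c') \<longrightarrow> c \<in> A)"


section \<open>Differential forms\<close>

text \<open>A form \<open>\<omega>\<close> is given by its coordinate representations: \<open>\<omega> c z v\<close> is the value, in the
  chart \<open>c\<close> at the coordinate point \<open>z\<close>, on the tangent vectors \<open>v 0, v 1, ...\<close> (written in the
  coordinates of \<open>c\<close>). A \<open>k\<close>-form only looks at \<open>v 0, ..., v (k - 1)\<close>. Only the values for
  \<open>c \<in> A\<close> and \<open>z \<in> chart_img c\<close> are meaningful, so forms are compared with \<open>form_eq\<close>.\<close>

type_synonym ('a, 'e) form = "('a, 'e) chart \<Rightarrow> 'e \<Rightarrow> (nat \<Rightarrow> 'e) \<Rightarrow> real"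

definition alternating_multilinear :: "nat \<Rightarrow> ((nat \<Rightarrow> 'e::euclidean_space) \<Rightarrow> real) \<Rightarrow> bool" where
  "alternating_multilinear k f \<longleftrightarrow>
     (\<forall>v w. (\<forall>i<k. v i = w i) \<longrightarrow> f v = f w) \<and>
     (\<forall>v. \<forall>i<k. linear (\<lambda>x. f (v(i := x)))) \<and>
     (\<forall>v. \<forall>i<k. \<forall>j<k. i \<noteq> j \<and> v i = v j \<longrightarrow> f v = 0)"

text \<open>The last clause says that the representations are related by pullback along the
  transition maps.\<close>

definition diff_form :: "('a, 'e::euclidean_space) chart set \<Rightarrow> nat \<Rightarrow> ('a, 'e) form \<Rightarrow> bool" where
  "diff_form A k \<omega> \<longleftrightarrow>
     (\<forall>c\<in>A. \<forall>z\<in>chart_img c. alternating_multilinear k (\<omega> c z)) \<and>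
     (\<forall>c\<in>A. \<forall>v. smooth_on (chart_img c) (\<lambda>z. \<omega> c z v)) \<and>
     (\<forall>c\<in>A. \<forall>c'\<in>A. \<forall>z\<in>chart_overlap c c'. \<forall>v.
        \<omega> c z v =
        \<omega> c' (transition c c' z) (\<lambda>i. frechet_derivative (transition c c') (at z) (v i)))"

definition form_eq :: "('a, 'e) chart set \<Rightarrow> ('a, 'e) form \<Rightarrow> ('a, 'e) form \<Rightarrow> bool" where
  "form_eq A \<omega> \<eta> \<longleftrightarrow> (\<forall>c\<in>A. \<forall>z\<in>chart_img c. \<forall>v. \<omega> c z v = \<eta> c z v)"

definition zero_form :: "('a, 'e) form" where
  "zero_form = (\<lambda>c z v. 0)"

definition form_add :: "('a, 'e) form \<Rightarrow> ('a, 'e) form \<Rightarrow> ('a, 'e) form" where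
  "form_add \<omega> \<eta> = (\<lambda>c z v. \<omega> c z v + \<eta> c z v)"

definition form_diff :: "('a, 'e) form \<Rightarrow> ('a, 'e) form \<Rightarrow> ('a, 'e) form" where
  "form_diff \<omega> \<eta> = (\<lambda>c z v. \<omega> c z v - \<eta> c z v)"

text \<open>Wedge product of a \<open>k\<close>-form and an \<open>l\<close>-form, normalised by \<open>1 / (k! l!)\<close>, so that
  for 1-forms it is \<open>\<alpha>(v\<^sub>0) \<beta>(v\<^sub>1) - \<alpha>(v\<^sub>1) \<beta>(v\<^sub>0)\<close>.\<close>

definition wedge :: "nat \<Rightarrow> nat \<Rightarrow> ('a, 'e) form \<Rightarrow> ('a, 'e) form \<Rightarrow> ('a, 'e) form" where
  "wedge k l \<omega> \<eta> = (\<lambda>c z v.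
     (\<Sum>\<sigma> | \<sigma> permutes {..<k + l}.
        real_of_int (sign \<sigma>) * \<omega> c z (\<lambda>i. v (\<sigma> i)) * \<eta> c z (\<lambda>i. v (\<sigma> (k + i))))
     / (fact k * fact l))"

text \<open>Exterior derivative of a \<open>k\<close>-form in coordinates; the bracketed function is the tuple
  \<open>v\<close> with its entry \<open>v i\<close> omitted. The normalisation is the one matching \<open>wedge\<close>:
  for a 1-form it gives \<open>D\<omega>(v\<^sub>0)(v\<^sub>1) - D\<omega>(v\<^sub>1)(v\<^sub>0)\<close>.\<close>

definition ext_d :: "nat \<Rightarrow> ('a, 'e::euclidean_space) form \<Rightarrow> ('a, 'e) form" where
  "ext_d k \<omega> = (\<lambda>c z v.
     \<Sum>i\<le>k. (- 1) ^ i *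
       frechet_derivative (\<lambda>y. \<omega> c y (\<lambda>j. if j < i then v j else v (Suc j))) (at z) (v i))"

definition closed_form :: "('a, 'e::euclidean_space) chart set \<Rightarrow> nat \<Rightarrow> ('a, 'e) form \<Rightarrow> bool" where
  "closed_form A k \<omega> \<longleftrightarrow> form_eq A (ext_d k \<omega>) zero_form"

definition exact_form :: "('a, 'e::euclidean_space) chart set \<Rightarrow> nat \<Rightarrow> ('a, 'e) form \<Rightarrow> bool" where
  "exact_form A k \<omega> \<longleftrightarrow> (\<exists>j \<eta>. k = Suc j \<and> diff_form A j \<eta> \<and> form_eq A \<omega> (ext_d j \<eta>))"

text \<open>The element of \<open>H\<^sup>k(M, \<real>)\<close> represented by the closed \<open>k\<close>-form \<open>\<omega>\<close>: its coset modulo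
  exact forms in the space of closed \<open>k\<close>-forms. The zero of \<open>H\<^sup>k(M, \<real>)\<close> is the class of
  \<open>zero_form\<close>.\<close>

definition deRham_class ::
    "('a, 'e::euclidean_space) chart set \<Rightarrow> nat \<Rightarrow> ('a, 'e) form \<Rightarrow> ('a, 'e) form set" where
  "deRham_class A k \<omega> =
     {\<eta>. diff_form A k \<eta> \<and> closed_form A k \<eta> \<and> exact_form A k (form_diff \<omega> \<eta>)}"


section \<open>Families of forms over an open parameter interval\<close>

definition form_family ::
    "('a, 'e::euclidean_space) chart set \<Rightarrow> real set \<Rightarrow> nat \<Rightarrow> (real \<Rightarrow> ('a, 'e) form) \<Rightarrow> bool" where
  "form_family A J k \<omega> \<longleftrightarrow>
     (\<forall>t\<in>J. diff_form A k (\<omega> t)) \<and>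
     (\<forall>c\<in>A. \<forall>v. smooth_on (J \<times> chart_img c) (\<lambda>p. \<omega> (fst p) c (snd p) v))"

definition form_dot :: "(real \<Rightarrow> ('a, 'e) form) \<Rightarrow> real \<Rightarrow> ('a, 'e) form" where
  "form_dot \<omega> t = (\<lambda>c z v. deriv (\<lambda>s. \<omega> s c z v) t)"

definition vanishes :: "('a, 'e) chart set \<Rightarrow> real set \<Rightarrow> (real \<Rightarrow> ('a, 'e) form) \<Rightarrow> bool" where
  "vanishes A J \<omega> \<longleftrightarrow> (\<forall>t\<in>J. form_eq A (\<omega> t) zero_form)"

definition closed_1family ::
    "('a, 'e::euclidean_space) chart set \<Rightarrow> real set \<Rightarrow> (real \<Rightarrow> ('a, 'e) form) \<Rightarrow> bool" where
  "closed_1family A J \<omega> \<longleftrightarrow> (\<forall>t\<in>J. closed_form A 1 (\<omega> t))"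


section \<open>Transversely oriented codimension one foliations\<close>

text \<open>A fixed linear coordinate on the model space. In a foliated chart its level sets are the
  plaques, so the leaf directions are its kernel, and the positive transverse directions are
  those on which it is positive.\<close>

definition transverse_coord :: "'e::euclidean_space \<Rightarrow> real" where
  "transverse_coord z = z \<bullet> (SOME b. b \<in> Basis)"

text \<open>A foliation is given by a foliated atlas contained in the smooth structure: coordinate
  changes locally have the form \<open>(x, y) \<mapsto> (g (x, y), h y)\<close> with \<open>y\<close> the transverse coordinate,
  and \<open>h' > 0\<close> expresses the transverse orientation.\<close>

definition oriented_foliation ::
    "'a topology \<Rightarrow> ('a, 'e::euclidean_space) chart set \<Rightarrow> ('a, 'e) chart set \<Rightarrow> bool" where
  "oriented_foliation X A F \<longleftrightarrow>
     F \<subseteq> A \<and> (\<Union>c\<in>F. fst c) = topspace X \<and>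
     (\<forall>c\<in>F. \<forall>c'\<in>F. \<forall>z0\<in>chart_overlap c c'.
        \<exists>W I (h :: real \<Rightarrow> real).
          open W \<and> z0 \<in> W \<and> W \<subseteq> chart_overlap c c' \<and>
          open I \<and> is_interval I \<and> smooth_on I h \<and> (\<forall>y\<in>I. deriv h y > 0) \<and>
          (\<forall>z\<in>W. transverse_coord z \<in> I \<and>
             transverse_coord (transition c c' z) = h (transverse_coord z)))"

text \<open>Defining form: nowhere vanishing, its kernel is the tangent bundle of the foliation, and it
  is positive on positively oriented transverse vectors.\<close>

definition defining_form ::
    "('a, 'e::euclidean_space) chart set \<Rightarrow> ('a, 'e) chart set \<Rightarrow> ('a, 'e) form \<Rightarrow> bool" where
  "defining_form A F \<alpha> \<longleftrightarrow>
     diff_form A 1 \<alpha> \<and>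
     (\<forall>c\<in>A. \<forall>z\<in>chart_img c. \<exists>v. \<alpha> c z v \<noteq> 0) \<and>
     (\<forall>c\<in>F. \<forall>z\<in>chart_img c. \<forall>v.
        (\<alpha> c z v = 0 \<longleftrightarrow> transverse_coord (v 0) = 0) \<and>
        (transverse_coord (v 0) > 0 \<longrightarrow> \<alpha> c z v > 0))"

text \<open>A smooth family: the transversely oriented tangent hyperplane field depends smoothly on the
  parameter and the point, i.e. locally in \<open>J \<times> M\<close> it is the cooriented kernel of linear
  functionals \<open>\<theta> t z\<close> that depend smoothly on \<open>(t, z)\<close>. The vector \<open>u\<close> below is transported to
  the foliated chart \<open>c'\<close> of the foliation with parameter \<open>t\<close>.\<close>

definition smooth_foliation_family ::
    "'a topology \<Rightarrow> ('a, 'e::euclidean_space) chart set \<Rightarrow> real set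
       \<Rightarrow> (real \<Rightarrow> ('a, 'e) chart set) \<Rightarrow> bool" where
  "smooth_foliation_family X A J F \<longleftrightarrow>
     (\<forall>t\<in>J. oriented_foliation X A (F t)) \<and>
     (\<forall>t0\<in>J. \<forall>p\<in>topspace X.
        \<exists>c\<in>A. \<exists>I (\<theta> :: real \<Rightarrow> 'e \<Rightarrow> 'e \<Rightarrow> real).
          p \<in> fst c \<and> open I \<and> t0 \<in> I \<and> I \<subseteq> J \<and>
          (\<forall>t\<in>I. \<forall>z\<in>chart_img c. linear (\<theta> t z)) \<and>
          (\<forall>u. smooth_on (I \<times> chart_img c) (\<lambda>q. \<theta> (fst q) (snd q) u)) \<and>
          (\<forall>t\<in>I. \<forall>c'\<in>F t. \<forall>z\<in>chart_overlap c c'. \<forall>u.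
             let w = frechet_derivative (transition c c') (at z) u in
               (\<theta> t z u = 0 \<longleftrightarrow> transverse_coord w = 0) \<and>
               (transverse_coord w > 0 \<longrightarrow> \<theta> t z u > 0)))"

definition defining_family ::
    "('a, 'e::euclidean_space) chart set \<Rightarrow> real set \<Rightarrow> (real \<Rightarrow> ('a, 'e) chart set)
       \<Rightarrow> (real \<Rightarrow> ('a, 'e) form) \<Rightarrow> bool" where
  "defining_family A J F \<alpha> \<longleftrightarrow> form_family A J 1 \<alpha> \<and> (\<forall>t\<in>J. defining_form A (F t) (\<alpha> t))"


section \<open>Structure equations and the class TGV\<close>

definition structure_beta ::
    "('a, 'e::euclidean_space) chart set \<Rightarrow> real set
       \<Rightarrow> (real \<Rightarrow> ('a, 'e) form) \<Rightarrow> (real \<Rightarrow> ('a, 'e) form) \<Rightarrow> bool" where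
  "structure_beta A J \<alpha> \<beta> \<longleftrightarrow>
     form_family A J 1 \<beta> \<and>
     (\<forall>t\<in>J. form_eq A (ext_d 1 (\<alpha> t)) (wedge 1 1 (\<alpha> t) (\<beta> t)))"

definition structure_gamma ::
    "('a, 'e::euclidean_space) chart set \<Rightarrow> real set
       \<Rightarrow> (real \<Rightarrow> ('a, 'e) form) \<Rightarrow> (real \<Rightarrow> ('a, 'e) form) \<Rightarrow> (real \<Rightarrow> ('a, 'e) form) \<Rightarrow> bool" where
  "structure_gamma A J \<alpha> \<beta> \<gamma> \<longleftrightarrow>
     structure_beta A J \<alpha> \<beta> \<and> form_family A J 1 \<gamma> \<and>
     (\<forall>t\<in>J. form_eq A (ext_d 1 (\<beta> t)) (wedge 1 1 (\<alpha> t) (\<gamma> t)))"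

definition structure_delta ::
    "('a, 'e::euclidean_space) chart set \<Rightarrow> real set
       \<Rightarrow> (real \<Rightarrow> ('a, 'e) form) \<Rightarrow> (real \<Rightarrow> ('a, 'e) form) \<Rightarrow> (real \<Rightarrow> ('a, 'e) form)
       \<Rightarrow> (real \<Rightarrow> ('a, 'e) form) \<Rightarrow> bool" where
  "structure_delta A J \<alpha> \<beta> \<gamma> \<delta> \<longleftrightarrow>
     structure_gamma A J \<alpha> \<beta> \<gamma> \<and> form_family A J 1 \<delta> \<and>
     (\<forall>t\<in>J. form_eq A (ext_d 1 (\<gamma> t))
        (form_add (wedge 1 1 (\<beta> t) (\<gamma> t)) (wedge 1 1 (\<alpha> t) (\<delta> t))))"

definition TGV_form :: "(real \<Rightarrow> ('a, 'e::euclidean_space) form) \<Rightarrow> real \<Rightarrow> ('a, 'e) form" where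
  "TGV_form \<beta> t = wedge 1 3 (form_dot \<beta> t) (wedge 1 2 (\<beta> t) (ext_d 1 (\<beta> t)))"

text \<open>The class does not depend on the choice of \<open>\<alpha>\<close> and \<open>\<beta>\<close>, so an arbitrary choice is made;
  \<open>TGV\<close> is thereby an invariant of the family of foliations alone.\<close>

definition TGV ::
    "('a, 'e::euclidean_space) chart set \<Rightarrow> real set \<Rightarrow> (real \<Rightarrow> ('a, 'e) chart set)
       \<Rightarrow> real \<Rightarrow> ('a, 'e) form set" where
  "TGV A J F t =
     deRham_class A 4
       (TGV_form (SOME \<beta>. \<exists>\<alpha>. defining_family A J F \<alpha> \<and> structure_beta A J \<alpha> \<beta>) t)"

end

theory Submission
  imports Defs
begin

text \<open>The time derivative \<open>\<partial>\<^sub>t\<close> commutes with \<open>d\<close>, which acts on \<open>M\<close> only. Since \<open>\<alpha>\<close> has no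
  zeros, \<open>\<alpha> \<and> d\<beta> = 0\<close> (which is \<open>dd\<alpha> = 0\<close>) says that \<open>d\<beta>\<close> is a multiple of \<open>\<alpha>\<close>. Hence
  \<open>d\<beta> \<and> d\<beta> = 0\<close> for all times, and differentiating in time gives \<open>d\<partial>\<^sub>t\<beta> \<and> d\<beta> = 0\<close>.
  All primitives below are sums of forms \<open>a \<and> de\<close> with 1-forms \<open>a\<close> and \<open>e\<close>, for which \<open>d(a \<and> de) = da \<and> de\<close>.

  \<^item> Independence of the choices. Two defining forms are related by \<open>\<alpha>\<^sub>1 = f \<alpha>\<close> with \<open>f > 0\<close>, and then
    \<open>\<beta>\<^sub>1 = \<beta> + dh + g \<alpha>\<^sub>1\<close> with \<open>h = - ln f\<close> (\<open>structure_pair_rescale\<close>). Adding \<open>dh\<close> changes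
    \<open>\<partial>\<^sub>t\<beta> \<and> \<beta> \<and> d\<beta>\<close> by the differential of \<open>(\<partial>\<^sub>th (\<beta> + dh) - h \<partial>\<^sub>t\<beta>) \<and> d\<beta>\<close> (\<open>tgv_add_grad\<close>). Adding
    \<open>g \<alpha>\<close>, where \<open>d\<alpha> = \<alpha> \<and> \<beta>\<close>, changes it by the differential of
    \<open>g \<beta> \<and> d\<partial>\<^sub>t\<alpha> - g\<^sup>2 / 2 \<partial>\<^sub>t\<alpha> \<and> d\<alpha>\<close> (\<open>tgv_add_multiple\<close>). So it suffices to find one admissible
    pair \<open>(\<alpha>, \<beta>)\<close> for which the form is exact.

  \<^item> A vanishing form is closed, so only closedness of \<open>\<alpha>\<close>, \<open>\<beta>\<close>, \<open>\<gamma>\<close> or \<open>\<delta>\<close> has to be treated.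
    If \<open>\<beta>\<close> is closed the form is zero; if \<open>\<alpha>\<close> is closed, \<open>\<beta> = 0\<close> is admissible. If \<open>\<gamma>\<close> is closed,
    \<open>0 = dd\<beta> = \<alpha> \<and> \<beta> \<and> \<gamma>\<close>, so \<open>\<beta> \<and> d\<beta> = \<beta> \<and> \<alpha> \<and> \<gamma> = 0\<close>. If \<open>\<delta>\<close> is closed, \<open>dd\<gamma> = 0\<close> yields
    \<open>\<alpha> \<and> \<beta> \<and> \<delta> = 0\<close>; then \<open>\<alpha> \<and> d\<gamma> = \<alpha> \<and> \<beta> \<and> \<gamma>\<close> and \<open>d\<partial>\<^sub>t\<alpha> = \<partial>\<^sub>t\<alpha> \<and> \<beta> + \<alpha> \<and> \<partial>\<^sub>t\<beta>\<close> give
    \<open>\<partial>\<^sub>t\<beta> \<and> \<beta> \<and> d\<beta> = d\<partial>\<^sub>t\<alpha> \<and> d\<gamma>\<close> (\<open>tgv_structure_delta\<close>).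

  The identities are verified pointwise in a chart, for coefficient functions on \<open>J \<times> chart_img c\<close>.
  What is global is that the functions \<open>h\<close>, \<open>g\<close> and the primitives are smooth and compatible with
  changes of charts; the latter rests on the symmetry of second derivatives, through the naturality
  of \<open>d\<close> (\<open>curl_pullback\<close>).\<close>

section \<open>Calculus of \<open>C\<^sup>k\<close> functions\<close>

lemma frechet_derivative_cong_open:
  assumes "open S" "x \<in> S" "\<And>y. y \<in> S \<Longrightarrow> f y = g y"
  shows "frechet_derivative f (at x) = frechet_derivative g (at x)"
proof -
  have "(f has_derivative D) (at x) \<longleftrightarrow> (g has_derivative D) (at x)" for D
    using assms has_derivative_transform_within_open[of f D x UNIV S g]
      has_derivative_transform_within_open[of g D x UNIV S f] by fastforce
  then show ?thesis unfolding frechet_derivative_def by simp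
qed

lemma differentiable_cong_open:
  assumes "open S" "x \<in> S" "\<And>y. y \<in> S \<Longrightarrow> f y = g y" "f differentiable (at x)"
  shows "g differentiable (at x)"
  using assms has_derivative_transform_within_open[of f _ x UNIV S g]
  unfolding differentiable_def by metis

lemma Ck_on_cong:
  assumes "open S" "\<And>x. x \<in> S \<Longrightarrow> f x = g x" "Ck_on k S f"
  shows "Ck_on k S g"
  using assms(2,3)
proof (induction k arbitrary: f g)
  case 0
  then show ?case by (simp cong: continuous_on_cong)
next
  case (Suc k)
  have "Ck_on k S (\<lambda>x. frechet_derivative g (at x) v)" for v
    by (rule Suc.IH[of "\<lambda>x. frechet_derivative f (at x) v"])
      (use Suc.prems frechet_derivative_cong_open[OF assms(1), of _ f g] in auto)
  then show ?case
    using Suc.prems differentiable_cong_open[OF assms(1), of _ f g] by auto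
qed

lemma Ck_on_Suc_D: "Ck_on (Suc k) S f \<Longrightarrow> Ck_on k S f"
proof (induction k arbitrary: f)
  case 0
  then show ?case
    by (simp add: continuous_on_eq_continuous_within differentiable_at_withinI
        differentiable_imp_continuous_within)
qed auto

lemma Ck_on_const: "Ck_on k S (\<lambda>x. c)"
  by (induction k arbitrary: c) auto

lemma frechet_derivative_add:
  assumes "f differentiable (at x)" "g differentiable (at x)"
  shows "frechet_derivative (\<lambda>x. f x + g x) (at x) v
    = frechet_derivative f (at x) v + frechet_derivative g (at x) v"
proof -
  have "((\<lambda>x. f x + g x) has_derivative (\<lambda>v. frechet_derivative f (at x) v + frechet_derivative g (at x) v)) (at x)"
    using assms by (simp add: has_derivative_add frechet_derivative_works)
  from frechet_derivative_at[OF this] show ?thesis by metis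
qed

lemma frechet_derivative_mult:
  fixes f g :: "'a::real_normed_vector \<Rightarrow> real"
  assumes "f differentiable (at x)" "g differentiable (at x)"
  shows "frechet_derivative (\<lambda>x. f x * g x) (at x) v
    = f x * frechet_derivative g (at x) v + frechet_derivative f (at x) v * g x"
proof -
  have "((\<lambda>x. f x * g x) has_derivative (\<lambda>v. f x * frechet_derivative g (at x) v + frechet_derivative f (at x) v * g x)) (at x)"
    using assms by (simp add: has_derivative_mult frechet_derivative_works)
  from frechet_derivative_at[OF this] show ?thesis by metis
qed

lemma frechet_derivative_comp_real:
  fixes f :: "'a::real_normed_vector \<Rightarrow> real"
  assumes "f differentiable (at x)" "DERIV \<phi> (f x) :> m"
  shows "(\<lambda>x. \<phi> (f x)) differentiable (at x)"
    "frechet_derivative (\<lambda>x. \<phi> (f x)) (at x) v = m * frechet_derivative f (at x) v"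
proof -
  have "(f has_derivative frechet_derivative f (at x)) (at x)"
    using assms by (auto simp: frechet_derivative_works)
  from has_derivative_compose[OF this assms(2)[unfolded has_field_derivative_def]]
  have *: "((\<lambda>x. \<phi> (f x)) has_derivative (\<lambda>v. m * frechet_derivative f (at x) v)) (at x)" .
  then show "(\<lambda>x. \<phi> (f x)) differentiable (at x)" by (auto simp: differentiable_def)
  show "frechet_derivative (\<lambda>x. \<phi> (f x)) (at x) v = m * frechet_derivative f (at x) v"
    using frechet_derivative_at[OF *] by metis
qed

lemma Ck_on_add:
  assumes "open S" "Ck_on k S f" "Ck_on k S g"
  shows "Ck_on k S (\<lambda>x. f x + g x)"
  using assms(2,3)
proof (induction k arbitrary: f g)
  case 0 then show ?case by (simp add: continuous_on_add continuous_on_mult)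
next
  case (Suc k)
  have "Ck_on k S (\<lambda>x. frechet_derivative (\<lambda>x. f x + g x) (at x) v)" for v
    by (rule Ck_on_cong[OF assms(1), where f="\<lambda>x. frechet_derivative f (at x) v + frechet_derivative g (at x) v"])
      (use Suc in \<open>auto simp: frechet_derivative_add\<close>)
  then show ?case using Suc.prems by simp
qed

lemma Ck_on_mult:
  fixes f g :: "'a::real_normed_vector \<Rightarrow> real"
  assumes "open S" "Ck_on k S f" "Ck_on k S g"
  shows "Ck_on k S (\<lambda>x. f x * g x)"
  using assms(2,3)
proof (induction k arbitrary: f g)
  case 0 then show ?case by (simp add: continuous_on_add continuous_on_mult)
next
  case (Suc k)
  note Ck_on_Suc_D[OF Suc.prems(1)] Ck_on_Suc_D[OF Suc.prems(2)]
  then have "Ck_on k S (\<lambda>x. f x * frechet_derivative g (at x) v + frechet_derivative f (at x) v * g x)" for v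
    using Suc by (intro Ck_on_add[OF assms(1)] Suc.IH) auto
  then have "Ck_on k S (\<lambda>x. frechet_derivative (\<lambda>x. f x * g x) (at x) v)" for v
    by (rule Ck_on_cong[OF assms(1), rotated]) (use Suc.prems in \<open>auto simp: frechet_derivative_mult\<close>)
  then show ?case using Suc.prems by simp
qed

lemma Ck_on_inverse:
  fixes f :: "'a::real_normed_vector \<Rightarrow> real"
  assumes "open S" "\<And>x. x \<in> S \<Longrightarrow> f x \<noteq> 0" "Ck_on k S f"
  shows "Ck_on k S (\<lambda>x. inverse (f x))"
  using assms(3)
proof (induction k)
  case 0 then show ?case using assms(2) by (simp add: continuous_on_inverse)
next
  case (Suc k)
  have D: "DERIV inverse (f x) :> - (inverse (f x) * inverse (f x))" if "x \<in> S" for x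
    using DERIV_inverse[OF assms(2)[OF that]] by (simp add: power2_eq_square)
  have d: "f differentiable (at x)" if "x \<in> S" for x using Suc.prems that by auto
  note i = Suc.IH[OF Ck_on_Suc_D[OF Suc.prems]]
  have *: "Ck_on k S (\<lambda>x. (-1) * (inverse (f x) * inverse (f x)) * frechet_derivative f (at x) v)" for v
    using Suc.prems i by (intro Ck_on_mult[OF assms(1)] Ck_on_const) auto
  have "Ck_on k S (\<lambda>x. frechet_derivative (\<lambda>x. inverse (f x)) (at x) v)" for v
    by (rule Ck_on_cong[OF assms(1) _ *[of v]]) (simp add: frechet_derivative_comp_real[OF d D])
  then show ?case using frechet_derivative_comp_real(1)[OF d D] by auto
qed

lemma Ck_on_ln:
  fixes f :: "'a::real_normed_vector \<Rightarrow> real"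
  assumes "open S" "\<And>x. x \<in> S \<Longrightarrow> f x > 0" "Ck_on k S f"
  shows "Ck_on k S (\<lambda>x. ln (f x))"
proof (cases k)
  case 0 then show ?thesis using assms(2,3) by (simp add: continuous_on_ln less_imp_neq[THEN not_sym])
next
  case (Suc l)
  have D: "DERIV ln (f x) :> inverse (f x)" if "x \<in> S" for x
    using DERIV_ln[OF assms(2)[OF that]] .
  have d: "f differentiable (at x)" if "x \<in> S" for x using assms(3) that Suc by auto
  have "Ck_on l S f" using Ck_on_Suc_D assms(3) Suc by blast
  then have *: "Ck_on l S (\<lambda>x. inverse (f x) * frechet_derivative f (at x) v)" for v
    using assms(2,3) Suc by (intro Ck_on_mult[OF assms(1)] Ck_on_inverse[OF assms(1)]) force+
  have "Ck_on l S (\<lambda>x. frechet_derivative (\<lambda>x. ln (f x)) (at x) v)" for v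
    by (rule Ck_on_cong[OF assms(1) _ *[of v]]) (simp add: frechet_derivative_comp_real[OF d D])
  then show ?thesis using frechet_derivative_comp_real(1)[OF d D] Suc by auto
qed

lemma frechet_derivative_inner_left:
  assumes "f differentiable (at x)"
  shows "(\<lambda>x. f x \<bullet> b) differentiable (at x)"
    "frechet_derivative (\<lambda>x. f x \<bullet> b) (at x) v = frechet_derivative f (at x) v \<bullet> b"
proof -
  have *: "((\<lambda>x. f x \<bullet> b) has_derivative (\<lambda>v. frechet_derivative f (at x) v \<bullet> b)) (at x)"
    using assms by (simp add: has_derivative_inner_left frechet_derivative_works)
  then show "(\<lambda>x. f x \<bullet> b) differentiable (at x)" by (auto simp: differentiable_def)
  show "frechet_derivative (\<lambda>x. f x \<bullet> b) (at x) v = frechet_derivative f (at x) v \<bullet> b"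
    using frechet_derivative_at[OF *] by metis
qed

lemma Ck_on_inner_left:
  assumes "open S" "Ck_on k S f"
  shows "Ck_on k S (\<lambda>x. f x \<bullet> b)"
  using assms(2)
proof (induction k arbitrary: f)
  case 0 then show ?case by (simp add: continuous_on_inner)
next
  case (Suc k)
  have "Ck_on k S (\<lambda>x. frechet_derivative (\<lambda>x. f x \<bullet> b) (at x) v)" for v
    by (rule Ck_on_cong[OF assms(1), where f="\<lambda>x. frechet_derivative f (at x) v \<bullet> b"])
      (use Suc in \<open>simp_all add: frechet_derivative_inner_left(2)\<close>)
  then show ?case using Suc.prems frechet_derivative_inner_left(1) by simp
qed

lemma frechet_derivative_slice:
  fixes f :: "'a::real_normed_vector \<times> 'b::real_normed_vector \<Rightarrow> 'c::real_normed_vector"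
  assumes "f differentiable (at (t, z))"
  shows "(\<lambda>y. f (t, y)) differentiable (at z)"
    "frechet_derivative (\<lambda>y. f (t, y)) (at z) v = frechet_derivative f (at (t, z)) (0, v)"
proof -
  have "((\<lambda>y. (t, y)) has_derivative (\<lambda>v. (0, v))) (at z)"
    by (rule has_derivative_Pair[OF has_derivative_const has_derivative_ident])
  from has_derivative_compose[OF this assms[unfolded frechet_derivative_works]]
  have *: "((\<lambda>y. f (t, y)) has_derivative (\<lambda>v. frechet_derivative f (at (t, z)) (0, v))) (at z)" .
  then show "(\<lambda>y. f (t, y)) differentiable (at z)" by (auto simp: differentiable_def)
  show "frechet_derivative (\<lambda>y. f (t, y)) (at z) v = frechet_derivative f (at (t, z)) (0, v)"
    using frechet_derivative_at[OF *] by metis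
qed

lemma deriv_slice:
  fixes f :: "real \<times> 'b::real_normed_vector \<Rightarrow> real"
  assumes "f differentiable (at (t, z))"
  shows "((\<lambda>s. f (s, z)) has_real_derivative frechet_derivative f (at (t, z)) (1, 0)) (at t)"
proof -
  have "((\<lambda>s. (s, z)) has_derivative (\<lambda>v. (v, 0))) (at t)"
    by (rule has_derivative_Pair[OF has_derivative_ident has_derivative_const])
  from has_derivative_compose[OF this assms[unfolded frechet_derivative_works]]
  have *: "((\<lambda>s. f (s, z)) has_derivative (\<lambda>v. frechet_derivative f (at (t, z)) (v, 0))) (at t)" .
  have "(\<lambda>v. frechet_derivative f (at (t, z)) (v, 0)) = (*) (frechet_derivative f (at (t, z)) (1, 0))"
  proof
    fix v show "frechet_derivative f (at (t, z)) (v, 0) = frechet_derivative f (at (t, z)) (1, 0) * v"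
      using linear_scale[OF linear_frechet_derivative[OF assms], of v "(1, 0)"] by simp
  qed
  with * show ?thesis unfolding has_field_derivative_def by (simp only:)
qed

lemma Ck_on_slice:
  fixes f :: "'a::real_normed_vector \<times> 'b::real_normed_vector \<Rightarrow> 'c::real_normed_vector"
  assumes "open U" "t \<in> J" "Ck_on k (J \<times> U) f"
  shows "Ck_on k U (\<lambda>z. f (t, z))"
  using assms(3)
proof (induction k arbitrary: f)
  case 0
  have "continuous_on U (\<lambda>z. (t, z))"
    by (intro continuous_on_Pair continuous_on_const continuous_on_id)
  with 0 assms(2) show ?case
    by (auto intro: continuous_on_compose2[of "J \<times> U" f U "\<lambda>z. (t, z)"])
next
  case (Suc k)
  have "Ck_on k U (\<lambda>x. frechet_derivative (\<lambda>y. f (t, y)) (at x) v)" for v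
    by (rule Ck_on_cong[OF assms(1), where f="\<lambda>x. frechet_derivative f (at (t, x)) (0, v)"])
      (use Suc.prems assms(2) Suc.IH[of "\<lambda>p. frechet_derivative f (at p) (0, v)"] in
        \<open>simp_all add: frechet_derivative_slice(2)[of f t]\<close>)
  then show ?case using Suc.prems assms(2) frechet_derivative_slice(1)[of f t] by simp
qed

section \<open>Symmetry of second derivatives\<close>

text \<open>The mean value theorem in direction \<open>v\<close> and then in direction \<open>w\<close>. The second difference on the left
  is symmetric in \<open>v\<close> and \<open>w\<close>, so swapping the two expresses it through the other mixed derivative.\<close>

lemma second_difference_mean_value:
  fixes f :: "'a::real_normed_vector \<Rightarrow> real"
  assumes "Ck_on 2 S f" "h > 0"
    and S: "\<And>s r. 0 \<le> s \<Longrightarrow> s \<le> h \<Longrightarrow> 0 \<le> r \<Longrightarrow> r \<le> h \<Longrightarrow> x + s *\<^sub>R v + r *\<^sub>R w \<in> S"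
  obtains s r where "0 \<le> s" "s \<le> h" "0 \<le> r" "r \<le> h"
    "f (x + h *\<^sub>R v + h *\<^sub>R w) - f (x + h *\<^sub>R v) - f (x + h *\<^sub>R w) + f x
      = h * h * frechet_derivative (\<lambda>y. frechet_derivative f (at y) v) (at (x + s *\<^sub>R v + r *\<^sub>R w)) w"
proof -
  have line: "((\<lambda>s. g (y + s *\<^sub>R u)) has_real_derivative frechet_derivative g (at (y + s *\<^sub>R u)) u) (at s)"
    if "g differentiable (at (y + s *\<^sub>R u))" for g :: "'a \<Rightarrow> real" and y u s
  proof -
    have "((\<lambda>s. y + s *\<^sub>R u) has_derivative (\<lambda>h. h *\<^sub>R u)) (at s)"
      by (auto intro!: derivative_eq_intros)
    from has_derivative_compose[OF this that[unfolded frechet_derivative_works]]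
    have *: "((\<lambda>s. g (y + s *\<^sub>R u)) has_derivative (\<lambda>h. frechet_derivative g (at (y + s *\<^sub>R u)) (h *\<^sub>R u))) (at s)" .
    have "frechet_derivative g (at (y + s *\<^sub>R u)) (h *\<^sub>R u) = frechet_derivative g (at (y + s *\<^sub>R u)) u * h" for h
      using linear_scale[OF linear_frechet_derivative[OF that], of h u] by simp
    with * show ?thesis unfolding has_field_derivative_def by (simp only:)
  qed
  have d1: "f differentiable (at y)" and d2: "(\<lambda>y. frechet_derivative f (at y) u) differentiable (at y)"
    if "y \<in> S" for y u
    using assms(1) that by (auto simp: numeral_2_eq_2)
  let ?g = "\<lambda>s. f ((x + h *\<^sub>R w) + s *\<^sub>R v) - f (x + s *\<^sub>R v)"
  let ?g' = "\<lambda>s. frechet_derivative f (at ((x + h *\<^sub>R w) + s *\<^sub>R v)) v - frechet_derivative f (at (x + s *\<^sub>R v)) v"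
  have "(?g has_real_derivative ?g' s) (at s)" if "0 \<le> s" "s \<le> h" for s
    using S[of s h] S[of s 0] that assms(2)
    by (intro DERIV_diff line d1) (auto simp: algebra_simps)
  from MVT2[of 0 h ?g ?g', OF assms(2) this]
  obtain s where s: "0 < s" "s < h" "?g h - ?g 0 = h * ?g' s" by auto
  let ?k = "\<lambda>r. frechet_derivative f (at ((x + s *\<^sub>R v) + r *\<^sub>R w)) v"
  let ?k' = "\<lambda>r. frechet_derivative (\<lambda>y. frechet_derivative f (at y) v) (at ((x + s *\<^sub>R v) + r *\<^sub>R w)) w"
  have "(?k has_real_derivative ?k' r) (at r)" if "0 \<le> r" "r \<le> h" for r
    using S[of s r] that s by (intro line d2) auto
  from MVT2[of 0 h ?k ?k', OF assms(2) this]
  obtain r where r: "0 < r" "r < h" "?k h - ?k 0 = h * ?k' r" by auto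
  have "?g' s = ?k h - ?k 0" by (simp add: algebra_simps)
  then have "?g h - ?g 0 = h * h * ?k' r" using s(3) r(3) by (simp add: algebra_simps)
  then show ?thesis using s r by (intro that[of s r]) (auto simp: algebra_simps)
qed

text \<open>Both mixed derivatives, taken at suitable points near \<open>x\<close>, equal the same quotient of a second difference by \<open>h\<^sup>2\<close>;
  continuity lets the points tend to \<open>x\<close>.\<close>

lemma second_derivative_symmetric_real:
  fixes f :: "'a::real_normed_vector \<Rightarrow> real"
  assumes "open S" "x \<in> S" "Ck_on 2 S f"
  shows "frechet_derivative (\<lambda>y. frechet_derivative f (at y) v) (at x) w
    = frechet_derivative (\<lambda>y. frechet_derivative f (at y) w) (at x) v"
proof -
  define A where "A v w = (\<lambda>y. frechet_derivative (\<lambda>y. frechet_derivative f (at y) v) (at y) w)" for v w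
  have c: "continuous (at x) (A v w)" for v w
    using assms by (auto simp: A_def numeral_2_eq_2 continuous_on_eq_continuous_at)
  have "\<bar>A v w x - A w v x\<bar> \<le> e" if "e > 0" for e
  proof -
    have ed: "\<exists>d>0. \<forall>y. dist y x < d \<longrightarrow> dist (A v w y) (A v w x) < e/2" for v w
      using c[of v w] half_gt_zero[OF that] unfolding continuous_at_eps_delta by blast
    obtain d1 where d1: "d1 > 0" "\<And>y. dist y x < d1 \<Longrightarrow> dist (A v w y) (A v w x) < e/2"
      using ed[of v w] by blast
    obtain d2 where d2: "d2 > 0" "\<And>y. dist y x < d2 \<Longrightarrow> dist (A w v y) (A w v x) < e/2"
      using ed[of w v] by blast
    obtain d3 where d3: "d3 > 0" "\<And>y. dist y x < d3 \<Longrightarrow> y \<in> S"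
      using assms(1,2) by (auto simp: open_dist)
    define d where "d = min d1 (min d2 d3)"
    \<comment> \<open>A step \<open>h\<close> with \<open>h N < d\<close> keeps the parallelogram spanned by \<open>h v\<close> and \<open>h w\<close> at \<open>x\<close> within distance \<open>d\<close>.\<close>
    define N where "N = norm v + norm w + 1"
    define h where "h = d / (2 * N)"
    have "d > 0" "N > 0" using d1 d2 d3 by (auto simp: d_def N_def add_nonneg_pos)
    then have "h > 0" by (simp add: h_def)
    have near: "dist (x + s *\<^sub>R v + r *\<^sub>R w) x < d" if "0 \<le> s" "s \<le> h" "0 \<le> r" "r \<le> h" for s r
    proof -
      have "dist (x + s *\<^sub>R v + r *\<^sub>R w) x \<le> norm (s *\<^sub>R v) + norm (r *\<^sub>R w)"
        using norm_triangle_ineq[of "s *\<^sub>R v" "r *\<^sub>R w"] by (simp add: dist_norm add.assoc)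
      also have "\<dots> \<le> h * norm v + h * norm w" using that by (auto intro!: add_mono mult_right_mono)
      also have "\<dots> \<le> h * N" using \<open>h > 0\<close> by (simp add: N_def algebra_simps)
      also have "\<dots> < d" using \<open>d > 0\<close> \<open>N > 0\<close> by (simp add: h_def)
      finally show ?thesis .
    qed
    have near': "dist (x + s *\<^sub>R w + r *\<^sub>R v) x < d" if "0 \<le> s" "s \<le> h" "0 \<le> r" "r \<le> h" for s r
      using near[of r s] that by (simp add: add_ac)
    obtain s r where 1: "0 \<le> s" "s \<le> h" "0 \<le> r" "r \<le> h"
      "f (x + h *\<^sub>R v + h *\<^sub>R w) - f (x + h *\<^sub>R v) - f (x + h *\<^sub>R w) + f x
      = h * h * A v w (x + s *\<^sub>R v + r *\<^sub>R w)"
      unfolding A_def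
      by (rule second_difference_mean_value[OF assms(3) \<open>h > 0\<close>, of x v w]) (use near d3 d_def in auto)
    obtain s' r' where 2: "0 \<le> s'" "s' \<le> h" "0 \<le> r'" "r' \<le> h"
      "f (x + h *\<^sub>R w + h *\<^sub>R v) - f (x + h *\<^sub>R w) - f (x + h *\<^sub>R v) + f x
      = h * h * A w v (x + s' *\<^sub>R w + r' *\<^sub>R v)"
      unfolding A_def
      by (rule second_difference_mean_value[OF assms(3) \<open>h > 0\<close>, of x w v]) (use near' d3 d_def in auto)
    have "h * h * A v w (x + s *\<^sub>R v + r *\<^sub>R w) = h * h * A w v (x + s' *\<^sub>R w + r' *\<^sub>R v)"
      using 1(5) 2(5) by (simp add: algebra_simps)
    then have "A v w (x + s *\<^sub>R v + r *\<^sub>R w) = A w v (x + s' *\<^sub>R w + r' *\<^sub>R v)"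
      using \<open>h > 0\<close> by simp
    moreover have "\<bar>A v w (x + s *\<^sub>R v + r *\<^sub>R w) - A v w x\<bar> < e/2"
      using d1(2)[of "x + s *\<^sub>R v + r *\<^sub>R w"] near[of s r] 1 by (auto simp: d_def dist_real_def)
    moreover have "\<bar>A w v (x + s' *\<^sub>R w + r' *\<^sub>R v) - A w v x\<bar> < e/2"
      using d2(2)[of "x + s' *\<^sub>R w + r' *\<^sub>R v"] near'[of s' r'] 2 by (auto simp: d_def dist_real_def)
    ultimately show ?thesis by argo
  qed
  then have "A v w x = A w v x"
    using field_le_epsilon[of "\<bar>A v w x - A w v x\<bar>" 0] by simp
  then show ?thesis by (simp add: A_def)
qed

lemma second_derivative_symmetric:
  fixes f :: "'a::real_normed_vector \<Rightarrow> 'b::euclidean_space"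
  assumes "open S" "x \<in> S" "Ck_on 2 S f"
  shows "frechet_derivative (\<lambda>y. frechet_derivative f (at y) v) (at x) w
    = frechet_derivative (\<lambda>y. frechet_derivative f (at y) w) (at x) v"
proof (rule euclidean_eqI)
  fix b :: 'b
  have d: "f differentiable (at y)" "(\<lambda>y. frechet_derivative f (at y) u) differentiable (at y)"
    if "y \<in> S" for y u
    using assms(3) that by (auto simp: numeral_2_eq_2)
  have *: "frechet_derivative (\<lambda>y. frechet_derivative f (at y) v) (at x) w \<bullet> b
    = frechet_derivative (\<lambda>y. frechet_derivative (\<lambda>y. f y \<bullet> b) (at y) v) (at x) w" for v w
  proof -
    have "frechet_derivative (\<lambda>y. frechet_derivative f (at y) v) (at x) w \<bullet> b
      = frechet_derivative (\<lambda>y. frechet_derivative f (at y) v \<bullet> b) (at x) w"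
      by (rule frechet_derivative_inner_left(2)[symmetric]) (use d assms in auto)
    also have "\<dots> = frechet_derivative (\<lambda>y. frechet_derivative (\<lambda>y. f y \<bullet> b) (at y) v) (at x) w"
      by (rule fun_cong[OF frechet_derivative_cong_open[OF assms(1,2)]])
        (simp add: frechet_derivative_inner_left(2)[OF d(1)])
    finally show ?thesis .
  qed
  show "frechet_derivative (\<lambda>y. frechet_derivative f (at y) v) (at x) w \<bullet> b =
      frechet_derivative (\<lambda>y. frechet_derivative f (at y) w) (at x) v \<bullet> b"
    unfolding *[of v w] *[of w v]
    by (rule second_derivative_symmetric_real[OF assms(1,2) Ck_on_inner_left[OF assms(1,3)]])
qed

section \<open>Pointwise exterior algebra\<close>

definition wedge11 :: "('e \<Rightarrow> real) \<Rightarrow> ('e \<Rightarrow> real) \<Rightarrow> 'e \<Rightarrow> 'e \<Rightarrow> real" where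
  "wedge11 a b x y = a x * b y - a y * b x"

definition wedge12 :: "('e \<Rightarrow> real) \<Rightarrow> ('e \<Rightarrow> 'e \<Rightarrow> real) \<Rightarrow> 'e \<Rightarrow> 'e \<Rightarrow> 'e \<Rightarrow> real" where
  "wedge12 a B x y z = a x * B y z - a y * B x z + a z * B x y"

definition wedge22 :: "('e \<Rightarrow> 'e \<Rightarrow> real) \<Rightarrow> ('e \<Rightarrow> 'e \<Rightarrow> real) \<Rightarrow> 'e \<Rightarrow> 'e \<Rightarrow> 'e \<Rightarrow> 'e \<Rightarrow> real" where
  "wedge22 B C x y z w = B x y * C z w - B x z * C y w + B x w * C y z
     + B y z * C x w - B y w * C x z + B z w * C x y"

lemmas wedge_defs = wedge11_def wedge12_def wedge22_def

text \<open>The factor \<open>c\<close> is the contraction of \<open>B\<close> with \<open>u\<close>, divided by \<open>a u\<close>.\<close>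

lemma factor_if_wedge_zero:
  assumes "\<And>x y z. wedge12 a B x y z = 0" "a u \<noteq> 0"
  obtains c where "\<And>x y. B x y = wedge11 a c x y"
proof
  fix x y
  show "B x y = wedge11 a (\<lambda>y. B u y / a u) x y"
    using assms(1)[of u x y] assms(2) by (simp add: wedge_defs field_simps)
qed

text \<open>What remains of the change of \<open>\<partial>\<^sub>t\<beta> \<and> \<beta> \<and> d\<beta>\<close> under \<open>\<beta> \<mapsto> \<beta> + g \<alpha>\<close> once all derivatives are replaced
  by independent variables: \<open>bd\<close>, \<open>ad\<close>, \<open>gd\<close> stand for time derivatives, \<open>dg\<close> for the differential
  of \<open>g\<close>, and \<open>B = \<alpha> \<and> c\<close> for \<open>d\<beta>\<close>.\<close>

lemma tgv_shift_polynomial_identity: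
  assumes "\<And>x y. B x y = wedge11 a c x y"
  shows "wedge22 (wedge11 (\<lambda>x. bd x + gd * a x + g * ad x) (\<lambda>x. b x + g * a x))
      (\<lambda>x y. B x y + (wedge11 dg a x y + g * wedge11 a b x y)) x y z w - wedge22 (wedge11 bd b) B x y z w
    = wedge22 (\<lambda>x y. wedge11 dg b x y + g * B x y) (\<lambda>x y. wedge11 ad b x y + wedge11 a bd x y) x y z w
      - 1/2 * wedge22 (\<lambda>x y. 2 * g * wedge11 dg ad x y + g * g * (wedge11 ad b x y + wedge11 a bd x y)) (wedge11 a b) x y z w"
  unfolding wedge_defs assms by algebra

text \<open>The right-hand side is \<open>d\<partial>\<^sub>t\<alpha> \<and> d\<gamma>\<close> expanded by the structure equations; up to sign,
  the two sides differ by \<open>\<partial>\<^sub>t\<alpha> \<and> \<alpha> \<and> \<beta> \<and> \<delta>\<close>.\<close>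

lemma tgv_delta_polynomial_identity:
  assumes "wedge12 a (wedge11 b e) x y z = 0" "wedge12 a (wedge11 b e) x y w = 0" "wedge12 a (wedge11 b e) x z w = 0" "wedge12 a (wedge11 b e) y z w = 0"
  shows "wedge22 (wedge11 bd b) (wedge11 a c) x y z w
    = wedge22 (\<lambda>x y. wedge11 ad b x y + wedge11 a bd x y) (\<lambda>x y. wedge11 b c x y + wedge11 a e x y) x y z w"
  using assms unfolding wedge_defs by algebra

section \<open>Smooth functions\<close>

lemma smooth_on_const: "smooth_on S (\<lambda>x. c)" by (simp add: smooth_on_def Ck_on_const)

lemma smooth_on_add: "open S \<Longrightarrow> smooth_on S f \<Longrightarrow> smooth_on S g \<Longrightarrow> smooth_on S (\<lambda>x. f x + g x)"
  by (simp add: smooth_on_def Ck_on_add)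

lemma smooth_on_mult:
  fixes f g :: "'a::real_normed_vector \<Rightarrow> real"
  shows "open S \<Longrightarrow> smooth_on S f \<Longrightarrow> smooth_on S g \<Longrightarrow> smooth_on S (\<lambda>x. f x * g x)"
  by (simp add: smooth_on_def Ck_on_mult)

lemma smooth_on_diff:
  fixes f g :: "'a::real_normed_vector \<Rightarrow> real"
  assumes "open S" "smooth_on S f" "smooth_on S g"
  shows "smooth_on S (\<lambda>x. f x - g x)"
  using smooth_on_add[OF assms(1,2) smooth_on_mult[OF assms(1) smooth_on_const[of S "-1"] assms(3)]] by simp

lemma smooth_on_divide:
  fixes f g :: "'a::real_normed_vector \<Rightarrow> real"
  assumes "open S" "smooth_on S f" "smooth_on S g" "\<And>x. x \<in> S \<Longrightarrow> g x \<noteq> 0"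
  shows "smooth_on S (\<lambda>x. f x / g x)"
  using assms by (simp add: smooth_on_def divide_inverse Ck_on_mult Ck_on_inverse)

lemma smooth_on_ln:
  fixes f :: "'a::real_normed_vector \<Rightarrow> real"
  shows "open S \<Longrightarrow> smooth_on S f \<Longrightarrow> (\<And>x. x \<in> S \<Longrightarrow> f x > 0) \<Longrightarrow> smooth_on S (\<lambda>x. ln (f x))"
  by (simp add: smooth_on_def Ck_on_ln)

lemma smooth_on_sum:
  fixes f :: "'i \<Rightarrow> 'a::real_normed_vector \<Rightarrow> real"
  assumes "open S" "\<And>i. i \<in> I \<Longrightarrow> smooth_on S (f i)"
  shows "smooth_on S (\<lambda>x. \<Sum>i\<in>I. f i x)"
  using assms(2) by (induction I rule: infinite_finite_induct) (auto intro: smooth_on_const smooth_on_add[OF assms(1)])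

lemma smooth_on_deriv: "smooth_on S f \<Longrightarrow> smooth_on S (\<lambda>x. frechet_derivative f (at x) v)"
  unfolding smooth_on_def by (metis Ck_on.simps(2))

lemma smooth_on_differentiable: "smooth_on S f \<Longrightarrow> x \<in> S \<Longrightarrow> f differentiable (at x)"
  unfolding smooth_on_def by (metis Ck_on.simps(2))

lemma frechet_derivative_diff:
  fixes f g :: "'a::real_normed_vector \<Rightarrow> real"
  assumes "f differentiable (at x)" "g differentiable (at x)"
  shows "frechet_derivative (\<lambda>x. f x - g x) (at x) v
    = frechet_derivative f (at x) v - frechet_derivative g (at x) v"
proof -
  have "((\<lambda>x. f x - g x) has_derivative (\<lambda>v. frechet_derivative f (at x) v - frechet_derivative g (at x) v)) (at x)"
    using assms by (simp add: has_derivative_diff frechet_derivative_works)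
  from frechet_derivative_at[OF this] show ?thesis by metis
qed

section \<open>Time-dependent 1-forms on an open set\<close>

text \<open>A family of 1-forms is a function of a point \<open>p = (t, z)\<close> and a tangent vector. Derivatives along
  \<open>M\<close> are derivatives at \<open>p\<close> in directions \<open>(0, x)\<close>, time derivatives those in direction \<open>(1, 0)\<close>;
  in this way symmetry of second derivatives on the product covers both \<open>dd = 0\<close> and the fact that
  \<open>d\<close> commutes with the time derivative.\<close>

abbreviation smooth_fam :: "(real \<times> 'e::euclidean_space) set \<Rightarrow> (real \<times> 'e \<Rightarrow> 'e \<Rightarrow> real) \<Rightarrow> bool" where
  "smooth_fam S a \<equiv> \<forall>x. smooth_on S (\<lambda>p. a p x)"

definition grad :: "(real \<times> 'e::euclidean_space \<Rightarrow> real) \<Rightarrow> real \<times> 'e \<Rightarrow> 'e \<Rightarrow> real" where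
  "grad h p x = frechet_derivative h (at p) (0, x)"

definition tder :: "(real \<times> 'e::euclidean_space \<Rightarrow> real) \<Rightarrow> real \<times> 'e \<Rightarrow> real" where
  "tder h p = frechet_derivative h (at p) (1, 0)"

text \<open>The exterior derivative of a 1-form at fixed time; \<open>x\<close>, \<open>y\<close> are treated as constant vector fields.\<close>

definition curl :: "(real \<times> 'e::euclidean_space \<Rightarrow> 'e \<Rightarrow> real) \<Rightarrow> real \<times> 'e \<Rightarrow> 'e \<Rightarrow> 'e \<Rightarrow> real" where
  "curl a p x y = grad (\<lambda>q. a q y) p x - grad (\<lambda>q. a q x) p y"

definition tdot :: "(real \<times> 'e::euclidean_space \<Rightarrow> 'e \<Rightarrow> real) \<Rightarrow> real \<times> 'e \<Rightarrow> 'e \<Rightarrow> real" where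
  "tdot a p x = tder (\<lambda>q. a q x) p"

text \<open>The form \<open>\<partial>\<^sub>t\<beta> \<and> \<beta> \<and> d\<beta>\<close>, bracketed as \<open>(\<partial>\<^sub>t\<beta> \<and> \<beta>) \<and> d\<beta>\<close> so that it is bilinear in a pair of 2-forms.\<close>

definition tgv :: "(real \<times> 'e::euclidean_space \<Rightarrow> 'e \<Rightarrow> real) \<Rightarrow> real \<times> 'e \<Rightarrow> 'e \<Rightarrow> 'e \<Rightarrow> 'e \<Rightarrow> 'e \<Rightarrow> real" where
  "tgv b p = wedge22 (wedge11 (tdot b p) (b p)) (curl b p)"

context
  fixes S :: "(real \<times> 'e::euclidean_space) set"
  assumes S: "open S"
begin

lemma smooth_grad: "smooth_on S h \<Longrightarrow> smooth_on S (\<lambda>p. grad h p x)"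
  and smooth_tder: "smooth_on S h \<Longrightarrow> smooth_on S (tder h)"
  by (simp_all add: grad_def tder_def[abs_def] smooth_on_deriv)

lemma smooth_curl: "smooth_fam S a \<Longrightarrow> smooth_on S (\<lambda>p. curl a p x y)"
  unfolding curl_def by (intro smooth_on_diff[OF S] smooth_grad) auto

lemma smooth_tdot: "smooth_fam S a \<Longrightarrow> smooth_on S (\<lambda>p. tdot a p x)"
  unfolding tdot_def by (intro smooth_tder) auto

lemma grad_tder_rules:
  assumes "smooth_on S f" "smooth_on S g" "p \<in> S"
  shows "grad (\<lambda>q. f q + g q) p x = grad f p x + grad g p x"
    "grad (\<lambda>q. f q - g q) p x = grad f p x - grad g p x"
    "grad (\<lambda>q. f q * g q) p x = f p * grad g p x + grad f p x * g p"
    "tder (\<lambda>q. f q + g q) p = tder f p + tder g p"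
    "tder (\<lambda>q. f q - g q) p = tder f p - tder g p"
    "tder (\<lambda>q. f q * g q) p = f p * tder g p + tder f p * g p"
  using assms by (simp_all add: grad_def tder_def frechet_derivative_add frechet_derivative_diff
      frechet_derivative_mult smooth_on_differentiable)

lemma grad_tder_cong:
  assumes "p \<in> S" "\<And>q. q \<in> S \<Longrightarrow> f q = g q"
  shows "grad f p x = grad g p x" "tder f p = tder g p"
  using frechet_derivative_cong_open[OF S assms] by (simp_all add: grad_def tder_def)

lemma grad_tder_commute:
  assumes "smooth_on S f" "p \<in> S"
  shows "grad (\<lambda>q. grad f q x) p y = grad (\<lambda>q. grad f q y) p x"
    "grad (tder f) p y = tder (\<lambda>q. grad f q y) p"
  using second_derivative_symmetric_real[OF S assms(2), of f] assms(1)
  by (simp_all add: grad_def tder_def[abs_def] smooth_on_def)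

lemma curl_cong: "p \<in> S \<Longrightarrow> (\<And>q x. q \<in> S \<Longrightarrow> a q x = b q x) \<Longrightarrow> curl a p = curl b p"
  using grad_tder_cong(1)[of p "\<lambda>q. a q _" "\<lambda>q. b q _"] by (simp add: curl_def fun_eq_iff)

lemma tdot_cong: "p \<in> S \<Longrightarrow> (\<And>q x. q \<in> S \<Longrightarrow> a q x = b q x) \<Longrightarrow> tdot a p = tdot b p"
  using grad_tder_cong(2)[of p "\<lambda>q. a q _" "\<lambda>q. b q _"] by (simp add: tdot_def fun_eq_iff)

lemma curl_rules:
  assumes "smooth_fam S a" "smooth_fam S b" "smooth_on S g" "p \<in> S"
  shows "curl (\<lambda>q x. a q x + b q x) p x y = curl a p x y + curl b p x y"
    "curl (\<lambda>q x. a q x - b q x) p x y = curl a p x y - curl b p x y"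
    "curl (\<lambda>q x. g q * a q x) p x y = wedge11 (grad g p) (a p) x y + g p * curl a p x y"
  using assms by (simp_all add: curl_def grad_tder_rules wedge11_def algebra_simps)

lemma curl_grad: "smooth_on S h \<Longrightarrow> p \<in> S \<Longrightarrow> curl (grad h) p x y = 0"
  unfolding curl_def using grad_tder_commute(1) by simp

lemma curl_tdot: "smooth_fam S a \<Longrightarrow> p \<in> S \<Longrightarrow> curl (tdot a) p x y = tder (\<lambda>q. curl a q x y) p"
  unfolding curl_def tdot_def by (simp add: grad_tder_rules smooth_grad grad_tder_commute)

text \<open>The identity \<open>dd = 0\<close>: the second derivatives cancel in pairs by symmetry.\<close>

lemma curl_closed:
  assumes "smooth_fam S a" "p \<in> S"
  shows "grad (\<lambda>q. curl a q y z) p x - grad (\<lambda>q. curl a q x z) p y + grad (\<lambda>q. curl a q x y) p z = 0"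
  using assms unfolding curl_def
  by (simp add: grad_tder_rules smooth_grad grad_tder_commute(1)[of _ p x y] grad_tder_commute(1)[of _ p x z]
      grad_tder_commute(1)[of _ p y z])

text \<open>The exterior derivative of the hypothesis \<open>curl a = b \<and> c + d \<and> e\<close>: the left side gives zero and the
  right side is expanded by the Leibniz rule.\<close>

lemma wedge_curl_identity:
  assumes "smooth_fam S a" "smooth_fam S b" "smooth_fam S c" "smooth_fam S d" "smooth_fam S e" "p \<in> S"
    and eq: "\<And>q x y. q \<in> S \<Longrightarrow> curl a q x y = wedge11 (b q) (c q) x y + wedge11 (d q) (e q) x y"
  shows "wedge12 (c p) (curl b p) x y z - wedge12 (b p) (curl c p) x y z
    + (wedge12 (e p) (curl d p) x y z - wedge12 (d p) (curl e p) x y z) = 0"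
proof -
  have "grad (\<lambda>q. curl a q x y) p z
    = grad (\<lambda>q. (b q x * c q y - b q y * c q x) + (d q x * e q y - d q y * e q x)) p z" for x y z
    by (rule grad_tder_cong(1)) (use assms in \<open>auto simp: wedge11_def\<close>)
  also have "\<dots> x y z = (b p x * grad (\<lambda>q. c q y) p z + grad (\<lambda>q. b q x) p z * c p y
      - (b p y * grad (\<lambda>q. c q x) p z + grad (\<lambda>q. b q y) p z * c p x))
    + (d p x * grad (\<lambda>q. e q y) p z + grad (\<lambda>q. d q x) p z * e p y
      - (d p y * grad (\<lambda>q. e q x) p z + grad (\<lambda>q. d q y) p z * e p x))" for x y z
    using assms by (simp add: grad_tder_rules smooth_on_mult[OF S] smooth_on_diff[OF S])
  finally have *: "grad (\<lambda>q. curl a q x y) p z = (b p x * grad (\<lambda>q. c q y) p z + grad (\<lambda>q. b q x) p z * c p y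
      - (b p y * grad (\<lambda>q. c q x) p z + grad (\<lambda>q. b q y) p z * c p x))
    + (d p x * grad (\<lambda>q. e q y) p z + grad (\<lambda>q. d q x) p z * e p y
      - (d p y * grad (\<lambda>q. e q x) p z + grad (\<lambda>q. d q y) p z * e p x))" for x y z .
  from curl_closed[OF assms(1,6), where x=x and y=y and z=z] show ?thesis
    unfolding * unfolding curl_def wedge12_def by algebra
qed

text \<open>The first claim is \<open>dda = 0\<close>, because \<open>da \<and> b = a \<and> b \<and> b = 0\<close>; the second is the time derivative of
  the structure equation.\<close>

lemma structure_equation_consequences:
  assumes "smooth_fam S a" "smooth_fam S b" "p \<in> S"
    and eq: "\<And>q x y. q \<in> S \<Longrightarrow> curl a q x y = wedge11 (a q) (b q) x y"
  shows "wedge12 (a p) (curl b p) x y z = 0"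
    "curl (tdot a) p x y = wedge11 (tdot a p) (b p) x y + wedge11 (a p) (tdot b p) x y"
proof -
  \<comment> \<open>The identity for a single product, with zero as the second summand.\<close>
  have "wedge12 (b p) (curl a p) x y z - wedge12 (a p) (curl b p) x y z
    + (wedge12 (\<lambda>x. 0) (curl (\<lambda>q x. 0) p) x y z - wedge12 (\<lambda>x. 0) (curl (\<lambda>q x. 0) p) x y z) = 0"
    by (rule wedge_curl_identity) (use assms in \<open>auto simp: smooth_on_const wedge11_def\<close>)
  moreover have "wedge12 (b p) (curl a p) x y z = 0"
    unfolding wedge12_def eq[OF assms(3)] by (simp add: wedge11_def algebra_simps)
  ultimately show "wedge12 (a p) (curl b p) x y z = 0" by simp
  have "curl (tdot a) p x y = tder (\<lambda>q. a q x * b q y - a q y * b q x) p"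
    unfolding curl_tdot[OF assms(1,3)] by (rule grad_tder_cong(2)) (use assms in \<open>auto simp: wedge11_def\<close>)
  then show "curl (tdot a) p x y = wedge11 (tdot a p) (b p) x y + wedge11 (a p) (tdot b p) x y"
    using assms by (simp add: grad_tder_rules smooth_on_mult[OF S] wedge11_def tdot_def algebra_simps)
qed

text \<open>By \<open>a \<and> db = 0\<close> and \<open>a \<noteq> 0\<close>, the 2-form \<open>db\<close> has the factor \<open>a\<close>, and a decomposable 2-form has
  square zero.\<close>

lemma curl_square_zero:
  assumes "smooth_fam S a" "smooth_fam S b" "p \<in> S"
    and "\<And>q x y. q \<in> S \<Longrightarrow> curl a q x y = wedge11 (a q) (b q) x y"
    and "a p u \<noteq> 0"
  shows "wedge22 (curl b p) (curl b p) x y z w = 0"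
proof -
  obtain c where c: "\<And>x y. curl b p x y = wedge11 (a p) c x y"
    using factor_if_wedge_zero[of "a p" "curl b p" u] structure_equation_consequences(1)[OF assms(1-4)] assms(5)
    by metis
  show ?thesis unfolding wedge22_def c by (simp add: wedge11_def algebra_simps)
qed

text \<open>Half of the time derivative of \<open>db \<and> db = 0\<close>.\<close>

lemma curl_square_tdot:
  assumes "smooth_fam S b" "p \<in> S" "\<And>q x y z w. q \<in> S \<Longrightarrow> wedge22 (curl b q) (curl b q) x y z w = 0"
  shows "wedge22 (curl (tdot b) p) (curl b p) x y z w = 0"
proof -
  have "tder (\<lambda>q. curl b q x y * curl b q z w - curl b q x z * curl b q y w + curl b q x w * curl b q y z) p
    = tder (\<lambda>q. 0) p"
    proof (rule grad_tder_cong(2)[OF assms(2)])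
    fix q assume "q \<in> S"
    from assms(3)[OF this, of x y z w]
    show "curl b q x y * curl b q z w - curl b q x z * curl b q y w + curl b q x w * curl b q y z = 0"
      unfolding wedge22_def by algebra
  qed
  also have "\<dots> = 0" by (simp add: tder_def)
  finally have "curl b p x y * tder (\<lambda>q. curl b q z w) p + tder (\<lambda>q. curl b q x y) p * curl b p z w
    - (curl b p x z * tder (\<lambda>q. curl b q y w) p + tder (\<lambda>q. curl b q x z) p * curl b p y w)
    + (curl b p x w * tder (\<lambda>q. curl b q y z) p + tder (\<lambda>q. curl b q x w) p * curl b p y z) = 0"
    using assms(1,2) by (simp add: grad_tder_rules smooth_curl smooth_on_mult[OF S] smooth_on_diff[OF S])
  then show ?thesis unfolding wedge22_def curl_tdot[OF assms(1,2)] by (simp add: algebra_simps)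
qed

text \<open>The right-hand side is the differential of \<open>(\<partial>\<^sub>th (b + dh) - h \<partial>\<^sub>tb) \<and> db\<close>. Expanding it leaves the
  extra terms of \<open>(\<partial>\<^sub>tb + d\<partial>\<^sub>th) \<and> (b + dh) \<and> db\<close> and multiples of \<open>db \<and> db\<close> and \<open>d\<partial>\<^sub>tb \<and> db\<close>,
  which vanish.\<close>

lemma tgv_add_grad:
  assumes b: "smooth_fam S b" and h: "smooth_on S h" and p: "p \<in> S"
    and sq: "\<And>q x y z w. q \<in> S \<Longrightarrow> wedge22 (curl b q) (curl b q) x y z w = 0"
    and b': "\<And>q x. q \<in> S \<Longrightarrow> b' q x = b q x + grad h q x"
  shows "tgv b' p x y z w - tgv b p x y z w
    = wedge22 (curl (\<lambda>q x. tder h q * b' q x - h q * tdot b q x) p) (curl b p) x y z w"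
proof -
  define bb where "bb = (\<lambda>q x. b q x + grad h q x)"
  have bb: "smooth_fam S bb" using b h by (simp add: bb_def smooth_on_add[OF S] smooth_grad)
  have 1: "tdot b' p x = tdot b p x + grad (tder h) p x" for x
    using tdot_cong[OF p, of b' bb] b' b h p
    by (simp add: bb_def tdot_def grad_tder_rules smooth_grad grad_tder_commute)
  have 2: "curl b' p = curl b p"
    using curl_cong[OF p, of b' bb] b' curl_rules(1)[OF b _ _ p, of "grad h"] curl_grad[OF h p] h
    by (auto simp: bb_def smooth_grad fun_eq_iff)
  have bb2: "curl bb p = curl b p" using curl_cong[OF p, of bb b'] b' 2 by (simp add: bb_def)
  have 3: "curl (\<lambda>q x. tder h q * b' q x - h q * tdot b q x) p x y =
    wedge11 (grad (tder h) p) (bb p) x y + tder h p * curl b p x y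
    - (wedge11 (grad h p) (tdot b p) x y + h p * curl (tdot b) p x y)" for x y
  proof -
    have "curl (\<lambda>q x. tder h q * b' q x - h q * tdot b q x) p = curl (\<lambda>q x. tder h q * bb q x - h q * tdot b q x) p"
      by (rule curl_cong[OF p]) (simp add: bb_def b')
    then show ?thesis
      using b bb h p by (simp add: curl_rules smooth_tder smooth_tdot smooth_on_mult[OF S] bb2)
  qed
  show ?thesis
    using sq[OF p, of x y z w] curl_square_tdot[OF b p sq, of x y z w]
    unfolding tgv_def wedge22_def 2 3 unfolding wedge11_def 1 b'[OF p] bb_def
    by algebra
qed

text \<open>The right-hand side is the differential of \<open>g b \<and> d\<partial>\<^sub>ta - g\<^sup>2 / 2 \<partial>\<^sub>ta \<and> da\<close>. Once \<open>db = a \<and> c\<close> and the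
  structure equation are inserted, the claim is a polynomial identity.\<close>

lemma tgv_add_multiple:
  assumes a: "smooth_fam S a" and b: "smooth_fam S b" and g: "smooth_on S g" and p: "p \<in> S"
    and eq: "\<And>q x y. q \<in> S \<Longrightarrow> curl a q x y = wedge11 (a q) (b q) x y"
    and b': "\<And>q x. q \<in> S \<Longrightarrow> b' q x = b q x + g q * a q x"
    and u: "a p u \<noteq> 0"
  shows "tgv b' p x y z w - tgv b p x y z w
    = wedge22 (curl (\<lambda>q x. g q * b q x) p) (curl (tdot a) p) x y z w
      - 1/2 * wedge22 (curl (\<lambda>q x. (g q * g q) * tdot a q x) p) (curl a p) x y z w"
proof -
  define bb where "bb = (\<lambda>q x. b q x + g q * a q x)"
  note ab = structure_equation_consequences[OF a b p eq]
  obtain c where c: "\<And>x y. curl b p x y = wedge11 (a p) c x y"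
    using factor_if_wedge_zero[of "a p" "curl b p" u] ab(1) u by metis
  have 1: "tdot b' p = (\<lambda>x. tdot b p x + tder g p * a p x + g p * tdot a p x)"
  proof -
    have "tdot b' p = tdot bb p" by (rule tdot_cong[OF p]) (simp add: bb_def b')
    then show ?thesis using a b g p
      by (simp add: bb_def tdot_def grad_tder_rules smooth_on_mult[OF S] fun_eq_iff)
  qed
  have 2: "curl b' p = (\<lambda>x y. curl b p x y + (wedge11 (grad g p) (a p) x y + g p * wedge11 (a p) (b p) x y))"
  proof -
    have "curl b' p = curl bb p" by (rule curl_cong[OF p]) (simp add: bb_def b')
    then show ?thesis using a b g p
      by (simp add: bb_def curl_rules smooth_on_mult[OF S] eq[OF p] fun_eq_iff)
  qed
  have 3: "curl (\<lambda>q x. g q * b q x) p = (\<lambda>x y. wedge11 (grad g p) (b p) x y + g p * curl b p x y)"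
    using curl_rules(3)[OF b b g p] by blast
  have "wedge11 (grad (\<lambda>q. g q * g q) p) (tdot a p) x y = 2 * g p * wedge11 (grad g p) (tdot a p) x y" for x y
    using g p by (simp add: grad_tder_rules wedge11_def algebra_simps)
  then have 4: "curl (\<lambda>q x. (g q * g q) * tdot a q x) p
    = (\<lambda>x y. 2 * g p * wedge11 (grad g p) (tdot a p) x y + g p * g p * (wedge11 (tdot a p) (b p) x y + wedge11 (a p) (tdot b p) x y))"
    using curl_rules(3)[of "tdot a" "tdot a" "\<lambda>q. g q * g q", OF _ _ _ p] a g ab(2)
    by (simp add: smooth_tdot smooth_on_mult[OF S] fun_eq_iff)
  have 5: "curl a p = wedge11 (a p) (b p)" "curl (tdot a) p = (\<lambda>x y. wedge11 (tdot a p) (b p) x y + wedge11 (a p) (tdot b p) x y)"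
    using eq[OF p] ab(2) by blast+
  have 6: "b' p = (\<lambda>x. b p x + g p * a p x)" using b'[OF p] by blast
  show ?thesis unfolding tgv_def 1 2 3 4 5 6 by (rule tgv_shift_polynomial_identity[OF c])
qed

text \<open>As \<open>e\<close> is closed, \<open>ddc = 0\<close> reads \<open>2 a \<and> b \<and> e = 0\<close>, and this is the only term by which the two
  sides could differ.\<close>

lemma tgv_structure_delta:
  assumes "smooth_fam S a" "smooth_fam S b" "smooth_fam S c" "smooth_fam S e" "p \<in> S"
    and da: "\<And>q x y. q \<in> S \<Longrightarrow> curl a q x y = wedge11 (a q) (b q) x y"
    and db: "\<And>q x y. q \<in> S \<Longrightarrow> curl b q x y = wedge11 (a q) (c q) x y"
    and dc: "\<And>q x y. q \<in> S \<Longrightarrow> curl c q x y = wedge11 (b q) (c q) x y + wedge11 (a q) (e q) x y"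
    and de: "\<And>x y. curl e p x y = 0"
  shows "tgv b p x y z w = wedge22 (curl (tdot a) p) (curl c p) x y z w"
proof -
  have 1: "wedge12 (a p) (wedge11 (b p) (e p)) x y z = 0" for x y z
  proof -
    have "wedge12 (c p) (curl b p) x y z - wedge12 (b p) (curl c p) x y z
    + (wedge12 (e p) (curl a p) x y z - wedge12 (a p) (curl e p) x y z) = 0"
      by (rule wedge_curl_identity[OF assms(3,2,3,1,4) _ dc]) (use assms in auto)
    then show ?thesis unfolding wedge12_def de da[OF assms(5)] db[OF assms(5)] dc[OF assms(5)]
      unfolding wedge11_def by algebra
  qed
  have 2: "curl b p = wedge11 (a p) (c p)" using db[OF assms(5)] by blast
  have 3: "curl c p = (\<lambda>x y. wedge11 (b p) (c p) x y + wedge11 (a p) (e p) x y)" using dc[OF assms(5)] by blast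
  have 4: "curl (tdot a) p = (\<lambda>x y. wedge11 (tdot a p) (b p) x y + wedge11 (a p) (tdot b p) x y)"
    using structure_equation_consequences(2)[OF assms(1,2,5) da] by blast
  show ?thesis unfolding tgv_def 2 3 4 by (rule tgv_delta_polynomial_identity[OF 1 1 1 1])
qed

text \<open>As \<open>c\<close> is closed, \<open>ddb = 0\<close> reads \<open>a \<and> b \<and> c = 0\<close>, and \<open>b \<and> db = b \<and> a \<and> c\<close>.\<close>

lemma tgv_gamma_closed:
  assumes "smooth_fam S a" "smooth_fam S b" "smooth_fam S c" "p \<in> S"
    and da: "\<And>q x y. q \<in> S \<Longrightarrow> curl a q x y = wedge11 (a q) (b q) x y"
    and db: "\<And>q x y. q \<in> S \<Longrightarrow> curl b q x y = wedge11 (a q) (c q) x y"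
    and dc: "\<And>x y. curl c p x y = 0"
  shows "tgv b p x y z w = 0"
proof -
  have "wedge12 (c p) (wedge11 (a p) (b p)) x y z = 0" for x y z
  proof -
    have "wedge12 (c p) (curl a p) x y z - wedge12 (a p) (curl c p) x y z
      + (wedge12 (\<lambda>x. 0) (curl (\<lambda>q x. 0) p) x y z - wedge12 (\<lambda>x. 0) (curl (\<lambda>q x. 0) p) x y z) = 0"
      by (rule wedge_curl_identity[OF assms(2,1,3) _ _ assms(4)])
        (use db in \<open>auto simp: smooth_on_const wedge11_def\<close>)
    then show ?thesis unfolding wedge12_def dc da[OF assms(4)] by simp
  qed
  from this[of x y z] this[of x y w] this[of x z w] this[of y z w] show ?thesis
    unfolding tgv_def wedge22_def wedge12_def db[OF assms(4)] unfolding wedge11_def by algebra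
qed

text \<open>The identity \<open>d(a \<and> de) = da \<and> de\<close>, which produces all primitives.\<close>

lemma wedge12_curl_derivative:
  assumes "smooth_fam S a" "smooth_fam S e" "p \<in> S"
  shows "grad (\<lambda>q. wedge12 (a q) (curl e q) y z w) p x - grad (\<lambda>q. wedge12 (a q) (curl e q) x z w) p y
    + grad (\<lambda>q. wedge12 (a q) (curl e q) x y w) p z - grad (\<lambda>q. wedge12 (a q) (curl e q) x y z) p w
    = wedge22 (curl a p) (curl e p) x y z w"
proof -
  have *: "grad (\<lambda>q. wedge12 (a q) (curl e q) x y z) p u =
      a p x * grad (\<lambda>q. curl e q y z) p u + grad (\<lambda>q. a q x) p u * curl e p y z
    - (a p y * grad (\<lambda>q. curl e q x z) p u + grad (\<lambda>q. a q y) p u * curl e p x z)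
    + (a p z * grad (\<lambda>q. curl e q x y) p u + grad (\<lambda>q. a q z) p u * curl e p x y)" for x y z u
    unfolding wedge12_def using assms
    by (simp add: grad_tder_rules smooth_curl smooth_on_mult[OF S] smooth_on_diff[OF S])
  have cl: "grad (\<lambda>q. curl e q y z) p x = grad (\<lambda>q. curl e q x z) p y - grad (\<lambda>q. curl e q x y) p z" for x y z
    using curl_closed[OF assms(2,3), where x=x and y=y and z=z] by linarith
  have da: "curl a p x y = grad (\<lambda>q. a q y) p x - grad (\<lambda>q. a q x) p y" for x y by (simp add: curl_def)
  show ?thesis
    unfolding * wedge22_def da cl[where x=x and y=y and z=z] cl[where x=x and y=y and z=w]
      cl[where x=x and y=z and z=w] cl[where x=y and y=z and z=w]
    by (simp add: algebra_simps)
qed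

end

section \<open>Expansion of the permutation sums\<close>

lemmas permutation_sum_simps = lessThan_Suc sum_over_permutations_insert
  numeral_2_eq_2[symmetric] sign_compose sign_swap_id permutation_compose permutation_swap_id

lemma wedge_1_1:
  assumes "\<And>v. \<omega> c z v = a (v 0)" "\<And>v. \<eta> c z v = b (v 0)"
  shows "wedge 1 1 \<omega> \<eta> c z v = wedge11 a b (v 0) (v 1)"
proof -
  have 2: "{..<1 + 1::nat} = insert 1 (insert 0 {})" by auto
  show ?thesis
    unfolding wedge_def assms 2 by (simp add: permutation_sum_simps wedge11_def transpose_def)
qed

lemma wedge_1_2:
  assumes "\<And>v. \<omega> c z v = a (v 0)" "\<And>v. \<eta> c z v = B (v 0) (v 1)" "\<And>x y. B x y = - B y x"
  shows "wedge 1 2 \<omega> \<eta> c z v = wedge12 a B (v 0) (v 1) (v 2)"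
proof -
  have 3: "{..<1 + 2::nat} = insert 2 (insert 1 (insert 0 {}))" by auto
  show ?thesis
    unfolding wedge_def assms(1,2) 3
    by (simp add: permutation_sum_simps wedge12_def transpose_def fact_numeral,
        use assms(3)[of "v 0" "v 1"] assms(3)[of "v 0" "v 2"] assms(3)[of "v 1" "v 2"] in
          \<open>simp add: field_simps\<close>)
qed

lemma wedge_1_3:
  assumes "\<And>v. \<omega> c z v = a (v 0)" "\<And>v. \<eta> c z v = wedge12 b B (v 0) (v 1) (v 2)" "\<And>x y. B x y = - B y x"
  shows "wedge 1 3 \<omega> \<eta> c z v = wedge22 (wedge11 a b) B (v 0) (v 1) (v 2) (v 3)"
proof -
  have 4: "{..<1 + 3::nat} = insert 3 (insert 2 (insert 1 (insert 0 {})))" by auto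
  have B: "B (v 1) (v 0) = - B (v 0) (v 1)" "B (v 2) (v 0) = - B (v 0) (v 2)" "B (v 3) (v 0) = - B (v 0) (v 3)"
     "B (v 2) (v 1) = - B (v 1) (v 2)" "B (v 3) (v 1) = - B (v 1) (v 3)" "B (v 3) (v 2) = - B (v 2) (v 3)"
    using assms(3) by blast+
  show ?thesis
    unfolding wedge_def assms(1,2) 4
    by (simp add: permutation_sum_simps transpose_def fact_numeral,
        simp only: wedge_defs One_nat_def[symmetric] B,
        simp only: algebra_simps mult_minus_right mult_minus_left)
qed

section \<open>Linearity and the chain rule\<close>

lemma linear_basis_expansion:
  fixes f :: "'e::euclidean_space \<Rightarrow> real"
  assumes "linear f"
  shows "(\<Sum>b\<in>Basis. (w \<bullet> b) * f b) = f w"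
proof -
  have "f w = f (\<Sum>b\<in>Basis. (w \<bullet> b) *\<^sub>R b)" by (simp add: euclidean_representation)
  also have "\<dots> = (\<Sum>b\<in>Basis. (w \<bullet> b) * f b)"
    by (simp add: linear_sum[OF assms] linear_scale[OF assms])
  finally show ?thesis by simp
qed

lemma linear_grad:
  assumes "smooth_on S h" "p \<in> S"
  shows "linear (grad h p)"
proof -
  have "linear (frechet_derivative h (at p) \<circ> (\<lambda>x. (0, x)))"
    by (intro linear_compose linear_frechet_derivative smooth_on_differentiable[OF assms])
      (auto intro: linearI)
  then show ?thesis by (simp add: grad_def[abs_def] o_def)
qed

lemma linear_deriv_coefficient:
  assumes "open S" "smooth_fam S a" "\<And>q. q \<in> S \<Longrightarrow> linear (a q)" "p \<in> S"
  shows "linear (\<lambda>x. grad (\<lambda>q. a q x) p v)" "linear (tdot a p)"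
proof -
  have add: "a q (x + y) = a q x + a q y" if "q \<in> S" for q x y by (rule linear_add[OF assms(3)[OF that]])
  have scale: "a q (r *\<^sub>R x) = r * a q x" if "q \<in> S" for q x r
    using linear_scale[OF assms(3)[OF that]] by simp
  note c = grad_tder_cong[OF assms(1,4)]
  have 0: "grad (\<lambda>q. r) p v = 0" "tder (\<lambda>q. r) p = 0" for r :: real by (simp_all add: grad_def tder_def)
  show "linear (\<lambda>x. grad (\<lambda>q. a q x) p v)"
  proof (rule linearI)
    show "grad (\<lambda>q. a q (x + y)) p v = grad (\<lambda>q. a q x) p v + grad (\<lambda>q. a q y) p v" for x y
      using c(1)[OF add] grad_tder_rules(1)[OF assms(1)] assms(2,4) by simp
    show "grad (\<lambda>q. a q (r *\<^sub>R x)) p v = r *\<^sub>R grad (\<lambda>q. a q x) p v" for r x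
      using c(1)[OF scale] grad_tder_rules(3)[OF assms(1) smooth_on_const, of "\<lambda>q. a q x" p r] assms(2,4) 0 by simp
  qed
  show "linear (tdot a p)" unfolding tdot_def
  proof (rule linearI)
    show "tder (\<lambda>q. a q (x + y)) p = tder (\<lambda>q. a q x) p + tder (\<lambda>q. a q y) p" for x y
      using c(2)[OF add] grad_tder_rules(4)[OF assms(1)] assms(2,4) by simp
    show "tder (\<lambda>q. a q (r *\<^sub>R x)) p = r *\<^sub>R tder (\<lambda>q. a q x) p" for r x
      using c(2)[OF scale] grad_tder_rules(6)[OF assms(1) smooth_on_const, of "\<lambda>q. a q x" p r] assms(2,4) 0 by simp
  qed
qed

lemma linear_curl:
  assumes "open S" "smooth_fam S a" "\<And>q. q \<in> S \<Longrightarrow> linear (a q)" "p \<in> S"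
  shows "linear (\<lambda>x. curl a p x y)" "linear (\<lambda>y. curl a p x y)"
proof -
  note d = linear_deriv_coefficient(1)[OF assms] and g = linear_grad[OF assms(2)[rule_format] assms(4)]
  show "linear (\<lambda>x. curl a p x y)" "linear (\<lambda>y. curl a p x y)"
    unfolding curl_def
    using linear_add[OF d] linear_scale[OF d] linear_add[OF g] linear_scale[OF g]
    by (auto intro!: linearI simp: algebra_simps)
qed

lemma curl_antisym: "curl a p x y = - curl a p y x"
  by (simp add: curl_def)

lemma frechet_derivative_chain:
  assumes "T differentiable (at z)" "f differentiable (at (T z))"
  shows "(\<lambda>y. f (T y)) differentiable (at z)"
    "frechet_derivative (\<lambda>y. f (T y)) (at z) u = frechet_derivative f (at (T z)) (frechet_derivative T (at z) u)"
proof -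
  have *: "((\<lambda>y. f (T y)) has_derivative (\<lambda>u. frechet_derivative f (at (T z)) (frechet_derivative T (at z) u))) (at z)"
    by (rule has_derivative_compose[OF assms[unfolded frechet_derivative_works]])
  then show "(\<lambda>y. f (T y)) differentiable (at z)" by (auto simp: differentiable_def)
  show "frechet_derivative (\<lambda>y. f (T y)) (at z) u = frechet_derivative f (at (T z)) (frechet_derivative T (at z) u)"
    using frechet_derivative_at[OF *] by metis
qed

lemma smooth_slice:
  assumes "smooth_on (J \<times> U) h" "t \<in> J" "z \<in> U"
  shows "(\<lambda>y. h (t, y)) differentiable (at z)"
    "frechet_derivative (\<lambda>y. h (t, y)) (at z) v = grad h (t, z) v"
    "deriv (\<lambda>s. h (s, z)) t = tder h (t, z)"
proof -
  have d: "h differentiable (at (t, z))" using smooth_on_differentiable[OF assms(1)] assms(2,3) by simp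
  show "(\<lambda>y. h (t, y)) differentiable (at z)"
    "frechet_derivative (\<lambda>y. h (t, y)) (at z) v = grad h (t, z) v"
    using frechet_derivative_slice[OF d] by (simp_all add: grad_def)
  show "deriv (\<lambda>s. h (s, z)) t = tder h (t, z)"
    using DERIV_imp_deriv[OF deriv_slice[OF d]] by (simp add: tder_def)
qed

section \<open>Families of functions and 1-forms on the manifold\<close>

text \<open>A family of functions or of 1-forms on \<open>M\<close> is represented by its coefficients in every chart, as
  functions on \<open>J \<times> chart_img c\<close>, together with their compatibility under changes of charts.\<close>

definition scalar_family ::
  "('a, 'e::euclidean_space) chart set \<Rightarrow> real set \<Rightarrow> (('a, 'e) chart \<Rightarrow> real \<times> 'e \<Rightarrow> real) \<Rightarrow> bool" where
  "scalar_family A J h \<longleftrightarrow>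
     (\<forall>c\<in>A. smooth_on (J \<times> chart_img c) (h c)) \<and>
     (\<forall>c\<in>A. \<forall>c'\<in>A. \<forall>t\<in>J. \<forall>z\<in>chart_overlap c c'. h c (t, z) = h c' (t, transition c c' z))"

definition one_form_family ::
  "('a, 'e::euclidean_space) chart set \<Rightarrow> real set \<Rightarrow> (('a, 'e) chart \<Rightarrow> real \<times> 'e \<Rightarrow> 'e \<Rightarrow> real) \<Rightarrow> bool" where
  "one_form_family A J a \<longleftrightarrow>
     (\<forall>c\<in>A. smooth_fam (J \<times> chart_img c) (a c)) \<and>
     (\<forall>c\<in>A. \<forall>p\<in>J \<times> chart_img c. linear (a c p)) \<and>
     (\<forall>c\<in>A. \<forall>c'\<in>A. \<forall>t\<in>J. \<forall>z\<in>chart_overlap c c'. \<forall>x.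
        a c (t, z) x = a c' (t, transition c c' z) (frechet_derivative (transition c c') (at z) x))"

text \<open>The primitive \<open>a \<and> de\<close> of the 4-form \<open>da \<and> de\<close>.\<close>

definition wedge_curl ::
  "(('a, 'e::euclidean_space) chart \<Rightarrow> real \<times> 'e \<Rightarrow> 'e \<Rightarrow> real) \<Rightarrow> (('a, 'e) chart \<Rightarrow> real \<times> 'e \<Rightarrow> 'e \<Rightarrow> real)
    \<Rightarrow> real \<Rightarrow> ('a, 'e) form" where
  "wedge_curl a e t = (\<lambda>c z v. wedge12 (a c (t, z)) (curl (e c) (t, z)) (v 0) (v 1) (v 2))"

lemma overlap_subset: "chart_overlap c c' \<subseteq> chart_img c"
  by (auto simp: chart_overlap_def chart_img_def)

lemma scalar_familyD:
  assumes "scalar_family A J h" "c \<in> A"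
  shows "smooth_on (J \<times> chart_img c) (h c)"
    "\<lbrakk>c' \<in> A; t \<in> J; z \<in> chart_overlap c c'\<rbrakk> \<Longrightarrow> h c (t, z) = h c' (t, transition c c' z)"
  using assms by (auto simp: scalar_family_def)

lemma one_form_familyD:
  assumes "one_form_family A J a" "c \<in> A"
  shows "smooth_fam (J \<times> chart_img c) (a c)"
    "p \<in> J \<times> chart_img c \<Longrightarrow> linear (a c p)"
    "\<lbrakk>c' \<in> A; t \<in> J; z \<in> chart_overlap c c'\<rbrakk> \<Longrightarrow>
       a c (t, z) x = a c' (t, transition c c' z) (frechet_derivative (transition c c') (at z) x)"
  using assms by (auto simp: one_form_family_def)

text \<open>A 1-form looks at the first vector of the tuple only, so a constant tuple recovers its value.\<close>

definition coeff1 :: "(real \<Rightarrow> ('a, 'e::euclidean_space) form) \<Rightarrow> ('a, 'e) chart \<Rightarrow> real \<times> 'e \<Rightarrow> 'e \<Rightarrow> real" where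
  "coeff1 \<omega> c p x = \<omega> (fst p) c (snd p) (\<lambda>_. x)"

text \<open>The structure equation \<open>da = a \<and> b\<close> for a nowhere vanishing \<open>a\<close>: all that the argument for
  independence keeps of a defining form and its \<open>\<beta>\<close>.\<close>

definition structure_pair ::
  "('a, 'e::euclidean_space) chart set \<Rightarrow> real set \<Rightarrow> (('a, 'e) chart \<Rightarrow> real \<times> 'e \<Rightarrow> 'e \<Rightarrow> real)
    \<Rightarrow> (('a, 'e) chart \<Rightarrow> real \<times> 'e \<Rightarrow> 'e \<Rightarrow> real) \<Rightarrow> bool" where
  "structure_pair A J a b \<longleftrightarrow> one_form_family A J a \<and> one_form_family A J b \<and>
     (\<forall>c\<in>A. \<forall>p\<in>J \<times> chart_img c. (\<exists>u. a c p u \<noteq> 0) \<and>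
        (\<forall>x y. curl (a c) p x y = wedge11 (a c p) (b c p) x y))"

lemma structure_pairD:
  assumes "structure_pair A J a b"
  shows "one_form_family A J a" "one_form_family A J b"
    "\<lbrakk>c \<in> A; p \<in> J \<times> chart_img c\<rbrakk> \<Longrightarrow> \<exists>u. a c p u \<noteq> 0"
    "\<lbrakk>c \<in> A; p \<in> J \<times> chart_img c\<rbrakk> \<Longrightarrow> curl (a c) p x y = wedge11 (a c p) (b c p) x y"
  using assms unfolding structure_pair_def by blast+

definition tgv_coeff_form :: "(('a, 'e::euclidean_space) chart \<Rightarrow> real \<times> 'e \<Rightarrow> 'e \<Rightarrow> real) \<Rightarrow> real \<Rightarrow> ('a, 'e) form" where
  "tgv_coeff_form b t = (\<lambda>c z v. tgv (b c) (t, z) (v 0) (v 1) (v 2) (v 3))"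

text \<open>Modulo the common kernel every vector is a multiple of the basis vector \<open>b\<close> that defines the
  transverse coordinate, so \<open>g b / f b\<close> is the factor; it is positive as \<open>b\<close> is a positive vector.\<close>

lemma transverse_kernel_proportional:
  fixes f g :: "'e::euclidean_space \<Rightarrow> real"
  assumes "linear f" "linear g"
    and f: "\<And>w. f w = 0 \<longleftrightarrow> transverse_coord w = 0" "\<And>w. transverse_coord w > 0 \<Longrightarrow> f w > 0"
    and g: "\<And>w. g w = 0 \<longleftrightarrow> transverse_coord w = 0" "\<And>w. transverse_coord w > 0 \<Longrightarrow> g w > 0"
  obtains k where "k > 0" "\<And>w. g w = k * f w"
proof -
  define b :: 'e where "b = (SOME b. b \<in> Basis)"
  have b: "b \<in> Basis" unfolding b_def using someI_ex[of "\<lambda>b. b \<in> Basis"] nonempty_Basis by blast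
  have tc: "transverse_coord w = w \<bullet> b" for w :: 'e by (simp add: transverse_coord_def b_def)
  have "transverse_coord b > 0" using b by (simp add: tc)
  then have pos: "f b > 0" "g b > 0" using f(2) g(2) by blast+
  have ker: "transverse_coord (w - (w \<bullet> b) *\<^sub>R b) = 0" for w
    using b by (simp add: tc inner_diff_left)
  have "f (w - (w \<bullet> b) *\<^sub>R b) = 0" "g (w - (w \<bullet> b) *\<^sub>R b) = 0" for w
    by (rule f(1)[THEN iffD2, OF ker] g(1)[THEN iffD2, OF ker])+
  then have fg: "f w = (w \<bullet> b) * f b" "g w = (w \<bullet> b) * g b" for w
    using linear_diff[OF assms(1), of w "(w \<bullet> b) *\<^sub>R b"] linear_scale[OF assms(1), of "w \<bullet> b" b]
      linear_diff[OF assms(2), of w "(w \<bullet> b) *\<^sub>R b"] linear_scale[OF assms(2), of "w \<bullet> b" b]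
    by simp_all
  have "g w = g b / f b * f w" for w
    using pos fg(1)[of w] fg(2)[of w] by (simp add: field_simps)
  then show ?thesis by (rule that[OF divide_pos_pos[OF pos(2,1)]])
qed

context
  fixes X :: "'a topology" and A :: "('a, 'e::euclidean_space) chart set" and J :: "real set"
  assumes M: "smooth_manifold X A" and J: "open J"
begin

lemma chart_facts:
  assumes "c \<in> A"
  shows "open (chart_img c)" "openin X (fst c)" "inj_on (snd c) (fst c)"
    "homeomorphic_map (subtopology X (fst c)) (top_of_set (chart_img c)) (snd c)"
proof -
  have ic: "is_chart X c" using M assms by (simp add: smooth_manifold_def)
  then show "open (chart_img c)" "openin X (fst c)"
    and hm: "homeomorphic_map (subtopology X (fst c)) (top_of_set (chart_img c)) (snd c)"
    by (simp_all add: is_chart_def)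
  have "topspace (subtopology X (fst c)) = fst c"
    using ic openin_subset[of X "fst c"] by (auto simp: is_chart_def)
  with homeomorphic_imp_injective_map[OF hm] show "inj_on (snd c) (fst c)" by simp
qed

lemma open_chart_domain: "c \<in> A \<Longrightarrow> open (J \<times> chart_img c)"
  using J chart_facts(1) by (simp add: open_Times)

lemma overlap_open:
  assumes "c \<in> A" "c' \<in> A"
  shows "open (chart_overlap c c')"
proof -
  have "openin (subtopology X (fst c)) (fst c' \<inter> fst c)"
    by (rule openin_subtopology_Int[OF chart_facts(2)[OF assms(2)]])
  with homeomorphic_imp_open_map[OF chart_facts(4)[OF assms(1)]]
  have "openin (top_of_set (chart_img c)) (snd c ` (fst c' \<inter> fst c))"
    by (simp add: open_map_def)
  then show ?thesis
    using openin_open_trans[OF _ chart_facts(1)[OF assms(1)]] by (simp add: chart_overlap_def Int_commute)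
qed

lemma transition_in:
  assumes "c \<in> A" "z \<in> chart_overlap c c'"
  shows "transition c c' z \<in> chart_img c'"
  using assms(2) inv_into_f_f[OF chart_facts(3)[OF assms(1)]]
  by (auto simp: chart_overlap_def transition_def chart_img_def)

lemma transition_smooth:
  assumes "c \<in> A" "c' \<in> A"
  shows "smooth_on (chart_overlap c c') (transition c c')"
  using M assms by (simp add: smooth_manifold_def smoothly_compatible_def)

text \<open>Differentiating the pulled back coefficients \<open>e (T y) (DT y x)\<close> in direction \<open>u\<close> produces, besides
  the pullback of the derivative of \<open>e\<close>, the term \<open>e (T z) (D\<^sup>2T z x u)\<close>. It is symmetric in \<open>x\<close> and
  \<open>u\<close> and cancels in the exterior derivative.\<close>

lemma curl_pullback:
  assumes e: "one_form_family A J e" and c: "c \<in> A" "c' \<in> A" and t: "t \<in> J" and z: "z \<in> chart_overlap c c'"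
  defines "T \<equiv> transition c c'"
  shows "curl (e c) (t, z) x u
    = curl (e c') (t, T z) (frechet_derivative T (at z) x) (frechet_derivative T (at z) u)"
proof -
  let ?O = "chart_overlap c c'" and ?D = "\<lambda>y. frechet_derivative T (at y)"
  let ?H = "\<lambda>x u. frechet_derivative (\<lambda>y. ?D y x) (at z) u"
  note O = overlap_open[OF c]
  have zc: "z \<in> chart_img c" by (rule subsetD[OF overlap_subset z])
  have Tz: "T z \<in> chart_img c'" unfolding T_def by (rule transition_in[OF c(1) z])
  have sT: "smooth_on ?O T" unfolding T_def by (rule transition_smooth[OF c])
  note dT = smooth_on_differentiable[OF sT z]
  note S' = open_chart_domain[OF c(2)]
  note e1 = one_form_familyD[OF e c(1)] and e' = one_form_familyD[OF e c(2)]
  have key: "grad (\<lambda>q. e c q x) (t, z) u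
      = e c' (t, T z) (?H x u) + grad (\<lambda>q. e c' q (?D z x)) (t, T z) (?D z u)" for x u
  proof -
    have dd: "(\<lambda>y. ?D y x) differentiable (at z)"
      by (rule smooth_on_differentiable[OF smooth_on_deriv[OF sT] z])
    have "grad (\<lambda>q. e c q x) (t, z) u = frechet_derivative (\<lambda>y. e c (t, y) x) (at z) u"
      by (rule smooth_slice(2)[OF e1(1)[rule_format] t zc, symmetric])
    \<comment> \<open>Expanding \<open>DT y x\<close> in the basis separates the dependence on \<open>y\<close> through \<open>T y\<close> from that through \<open>DT y x\<close>.\<close>
    also have "\<dots> = frechet_derivative (\<lambda>y. \<Sum>b\<in>Basis. (?D y x \<bullet> b) * e c' (t, T y) b) (at z) u"
    proof (rule fun_cong[OF frechet_derivative_cong_open[OF O z]])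
      fix y assume y: "y \<in> ?O"
      show "e c (t, y) x = (\<Sum>b\<in>Basis. (?D y x \<bullet> b) * e c' (t, T y) b)"
        unfolding e1(3)[OF c(2) t y] T_def
        by (rule linear_basis_expansion[OF e'(2), symmetric]) (use transition_in[OF c(1) y] t in simp)
    qed
    also have "\<dots> = (\<Sum>b\<in>Basis. (?D z x \<bullet> b) * grad (\<lambda>q. e c' q b) (t, T z) (?D z u) + (?H x u \<bullet> b) * e c' (t, T z) b)"
    proof -
      have "((\<lambda>y. \<Sum>b\<in>Basis. (?D y x \<bullet> b) * e c' (t, T y) b) has_derivative
         (\<lambda>u. \<Sum>b\<in>Basis. (?D z x \<bullet> b) * grad (\<lambda>q. e c' q b) (t, T z) (?D z u) + (?H x u \<bullet> b) * e c' (t, T z) b)) (at z)"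
      proof (rule has_derivative_sum)
        fix b :: 'e
        have 1: "((\<lambda>y. ?D y x \<bullet> b) has_derivative (\<lambda>u. ?H x u \<bullet> b)) (at z)"
          using dd by (simp add: has_derivative_inner_left frechet_derivative_works)
        have sl: "(\<lambda>y. e c' (t, y) b) differentiable (at (T z))"
          "frechet_derivative (\<lambda>y. e c' (t, y) b) (at (T z)) v = grad (\<lambda>q. e c' q b) (t, T z) v" for v
          by (rule smooth_slice[OF e'(1)[rule_format] t Tz])+
        have 2: "((\<lambda>y. e c' (t, T y) b) has_derivative (\<lambda>u. grad (\<lambda>q. e c' q b) (t, T z) (?D z u))) (at z)"
        proof -
          have "frechet_derivative (\<lambda>y. e c' (t, T y) b) (at z) = (\<lambda>u. grad (\<lambda>q. e c' q b) (t, T z) (?D z u))"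
            by (rule ext) (simp only: frechet_derivative_chain(2)[OF dT sl(1)] sl(2))
          with frechet_derivative_chain(1)[OF dT sl(1)] show ?thesis
            unfolding frechet_derivative_works by (simp only:)
        qed
        show "((\<lambda>y. (?D y x \<bullet> b) * e c' (t, T y) b) has_derivative
          (\<lambda>u. (?D z x \<bullet> b) * grad (\<lambda>q. e c' q b) (t, T z) (?D z u) + (?H x u \<bullet> b) * e c' (t, T z) b)) (at z)"
          by (rule has_derivative_mult[OF 1 2])
      qed
      from fun_cong[OF frechet_derivative_at[OF this, symmetric]] show ?thesis .
    qed
    also have "\<dots> = e c' (t, T z) (?H x u) + grad (\<lambda>q. e c' q (?D z x)) (t, T z) (?D z u)"
    proof -
      have p: "(t, T z) \<in> J \<times> chart_img c'" using t Tz by simp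
      have "(\<Sum>b\<in>Basis. (?D z x \<bullet> b) * grad (\<lambda>q. e c' q b) (t, T z) (?D z u))
        = grad (\<lambda>q. e c' q (?D z x)) (t, T z) (?D z u)"
        by (rule linear_basis_expansion[OF linear_deriv_coefficient(1)[OF S' e'(1) e'(2) p]])
      then show ?thesis
        unfolding sum.distrib linear_basis_expansion[OF e'(2)[OF p]] by (simp only: add.commute)
    qed
    finally show ?thesis .
  qed
  have "?H x u = ?H u x"
    by (rule second_derivative_symmetric[OF O z]) (use sT in \<open>simp add: smooth_on_def\<close>)
  then show ?thesis unfolding curl_def key by simp
qed

lemma one_form_family_grad:
  assumes h: "scalar_family A J h"
  shows "one_form_family A J (\<lambda>c. grad (h c))"
  unfolding one_form_family_def
proof (intro conjI ballI allI)
  fix c p x assume c: "c \<in> A"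
  note hc = scalar_familyD[OF h c]
  show "smooth_on (J \<times> chart_img c) (\<lambda>p. grad (h c) p x)" by (rule smooth_grad[OF open_chart_domain[OF c] hc(1)])
  show "p \<in> J \<times> chart_img c \<Longrightarrow> linear (grad (h c) p)" by (rule linear_grad[OF hc(1)])
next
  fix c c' t z x assume c: "c \<in> A" "c' \<in> A" and t: "t \<in> J" and z: "z \<in> chart_overlap c c'"
  let ?T = "transition c c'"
  note hc = scalar_familyD[OF h c(1)] and hc' = scalar_familyD[OF h c(2)]
  have zc: "z \<in> chart_img c" by (rule subsetD[OF overlap_subset z])
  note Tz = transition_in[OF c(1) z]
  note dT = smooth_on_differentiable[OF transition_smooth[OF c] z]
  have "grad (h c) (t, z) x = frechet_derivative (\<lambda>y. h c (t, y)) (at z) x"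
    using smooth_slice(2)[OF hc(1) t zc] by simp
  also have "\<dots> = frechet_derivative (\<lambda>y. h c' (t, ?T y)) (at z) x"
    by (rule fun_cong[OF frechet_derivative_cong_open[OF overlap_open[OF c] z hc(2)[OF c(2) t]]])
  also have "\<dots> = grad (h c') (t, ?T z) (frechet_derivative ?T (at z) x)"
    using frechet_derivative_chain(2)[OF dT smooth_slice(1)[OF hc'(1) t Tz]] smooth_slice(2)[OF hc'(1) t Tz] by simp
  finally show "grad (h c) (t, z) x = grad (h c') (t, ?T z) (frechet_derivative ?T (at z) x)" .
qed

text \<open>The change of charts does not depend on time.\<close>

lemma tder_natural:
  assumes c: "c \<in> A" "c' \<in> A" and t: "t \<in> J" and z: "z \<in> chart_overlap c c'"
    and s: "smooth_on (J \<times> chart_img c) f" "smooth_on (J \<times> chart_img c') f'"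
    and eq: "\<And>s. s \<in> J \<Longrightarrow> f (s, z) = f' (s, transition c c' z)"
  shows "tder f (t, z) = tder f' (t, transition c c' z)"
proof -
  have zc: "z \<in> chart_img c" by (rule subsetD[OF overlap_subset z])
  have "deriv (\<lambda>s. f (s, z)) t = deriv (\<lambda>s. f' (s, transition c c' z)) t"
    by (rule deriv_cong_ev) (use eventually_nhds_in_open[OF J t] eq in \<open>auto elim: eventually_mono\<close>)
  then show ?thesis
    using smooth_slice(3)[OF s(1) t zc] smooth_slice(3)[OF s(2) t transition_in[OF c(1) z]] by simp
qed

lemma one_form_family_tdot:
  assumes a: "one_form_family A J a"
  shows "one_form_family A J (\<lambda>c. tdot (a c))"
  unfolding one_form_family_def
proof (intro conjI ballI allI)
  fix c p x assume c: "c \<in> A"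
  note ac = one_form_familyD[OF a c]
  show "smooth_on (J \<times> chart_img c) (\<lambda>p. tdot (a c) p x)" by (rule smooth_tdot[OF open_chart_domain[OF c] ac(1)])
  show "p \<in> J \<times> chart_img c \<Longrightarrow> linear (tdot (a c) p)"
    by (rule linear_deriv_coefficient(2)[OF open_chart_domain[OF c] ac(1,2)])
next
  fix c c' t z x assume c: "c \<in> A" "c' \<in> A" and t: "t \<in> J" and z: "z \<in> chart_overlap c c'"
  show "tdot (a c) (t, z) x = tdot (a c') (t, transition c c' z) (frechet_derivative (transition c c') (at z) x)"
    unfolding tdot_def
    by (rule tder_natural[OF c t z]) (use one_form_familyD[OF a] c z in auto)
qed

lemma scalar_family_tder:
  assumes h: "scalar_family A J h"
  shows "scalar_family A J (\<lambda>c. tder (h c))"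
  unfolding scalar_family_def
proof (intro conjI ballI)
  fix c assume c: "c \<in> A"
  show "smooth_on (J \<times> chart_img c) (tder (h c))"
    by (rule smooth_tder[OF open_chart_domain[OF c] scalar_familyD(1)[OF h c]])
next
  fix c c' t z assume c: "c \<in> A" "c' \<in> A" and t: "t \<in> J" and z: "z \<in> chart_overlap c c'"
  show "tder (h c) (t, z) = tder (h c') (t, transition c c' z)"
    by (rule tder_natural[OF c t z]) (use scalar_familyD[OF h] c z in auto)
qed

lemma scalar_family_mult:
  assumes "scalar_family A J g" "scalar_family A J h"
  shows "scalar_family A J (\<lambda>c p. g c p * h c p)"
  using assms unfolding scalar_family_def by (auto intro: smooth_on_mult[OF open_chart_domain])

lemma one_form_family_mult:
  assumes "scalar_family A J g" "one_form_family A J a"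
  shows "one_form_family A J (\<lambda>c p x. g c p * a c p x)"
proof -
  have "linear (\<lambda>x. g c p * a c p x)" if "linear (a c p)" for c p
    using linear_add[OF that] linear_scale[OF that] by (auto intro!: linearI simp: algebra_simps)
  then show ?thesis
    using assms unfolding scalar_family_def one_form_family_def
    by (auto intro: smooth_on_mult[OF open_chart_domain])
qed

lemma one_form_family_diff:
  assumes "one_form_family A J a" "one_form_family A J b"
  shows "one_form_family A J (\<lambda>c p x. a c p x - b c p x)"
  using assms unfolding one_form_family_def
  by (auto intro: smooth_on_diff[OF open_chart_domain] linear_compose_sub)

lemma diff_form_wedge_curl:
  assumes a: "one_form_family A J a" and e: "one_form_family A J e" and t: "t \<in> J"
  shows "diff_form A 3 (wedge_curl a e t)"
  unfolding diff_form_def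
proof (intro conjI ballI allI)
  fix c z assume c: "c \<in> A" and z: "z \<in> chart_img c"
  have p: "(t, z) \<in> J \<times> chart_img c" using t z by simp
  note la = one_form_familyD(2)[OF a c p]
  note le = linear_curl[OF open_chart_domain[OF c] one_form_familyD(1,2)[OF e c] p]
  note lin = linear_add[OF la] linear_scale[OF la] linear_add[OF le(1)] linear_scale[OF le(1)]
    linear_add[OF le(2)] linear_scale[OF le(2)]
  have less3: "i < 3 \<longleftrightarrow> i = 0 \<or> i = 1 \<or> i = 2" for i :: nat by auto
  have repeated: "wedge12 (a c (t, z)) (curl (e c) (t, z)) x x y = 0" "wedge12 (a c (t, z)) (curl (e c) (t, z)) x y x = 0"
    "wedge12 (a c (t, z)) (curl (e c) (t, z)) y x x = 0" for x y
    by (simp_all add: wedge12_def curl_def algebra_simps)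
  show "alternating_multilinear 3 (wedge_curl a e t c z)"
    unfolding alternating_multilinear_def
  proof (intro conjI allI impI)
    fix v w :: "nat \<Rightarrow> 'e" assume "\<forall>i<3. v i = w i"
    then show "wedge_curl a e t c z v = wedge_curl a e t c z w" by (simp add: wedge_curl_def less3)
  next
    fix v :: "nat \<Rightarrow> 'e" and i :: nat assume "i < 3"
    then show "linear (\<lambda>x. wedge_curl a e t c z (v(i := x)))"
      unfolding less3
      by (elim disjE) (auto simp: wedge_curl_def wedge12_def lin algebra_simps intro!: linearI)
  next
    fix v :: "nat \<Rightarrow> 'e" and i j :: nat assume "i < 3" "j < 3" "i \<noteq> j \<and> v i = v j"
    then show "wedge_curl a e t c z v = 0"
      unfolding less3 wedge_curl_def by (elim disjE conjE) (simp_all add: repeated)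
  qed
next
  fix c and v :: "nat \<Rightarrow> 'e" assume c: "c \<in> A"
  note S = open_chart_domain[OF c]
  have "smooth_on (J \<times> chart_img c) (\<lambda>p. wedge12 (a c p) (curl (e c) p) (v 0) (v 1) (v 2))"
    unfolding wedge12_def using one_form_familyD(1)[OF a c] one_form_familyD(1)[OF e c]
    by (intro smooth_on_add[OF S] smooth_on_diff[OF S] smooth_on_mult[OF S] smooth_curl[OF S]) auto
  then show "smooth_on (chart_img c) (\<lambda>z. wedge_curl a e t c z v)"
    unfolding wedge_curl_def smooth_on_def using Ck_on_slice[OF chart_facts(1)[OF c] t] by blast
next
  fix c c' z v assume "c \<in> A" "c' \<in> A" "z \<in> chart_overlap c c'"
  then show "wedge_curl a e t c z v = wedge_curl a e t c' (transition c c' z)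
      (\<lambda>i. frechet_derivative (transition c c') (at z) (v i))"
    unfolding wedge_curl_def wedge12_def
    using one_form_familyD(3)[OF a _ _ t] curl_pullback[OF e _ _ t] by simp
qed

lemma ext_d_wedge_curl:
  assumes a: "one_form_family A J a" and e: "one_form_family A J e" and t: "t \<in> J"
    and c: "c \<in> A" and z: "z \<in> chart_img c"
  shows "ext_d 3 (wedge_curl a e t) c z v
    = wedge22 (curl (a c) (t, z)) (curl (e c) (t, z)) (v 0) (v 1) (v 2) (v 3)"
proof -
  note S = open_chart_domain[OF c]
  have p: "(t, z) \<in> J \<times> chart_img c" using t z by simp
  have sl: "frechet_derivative (\<lambda>y. wedge12 (a c (t, y)) (curl (e c) (t, y)) x x' x'') (at z) u
    = grad (\<lambda>q. wedge12 (a c q) (curl (e c) q) x x' x'') (t, z) u" for x x' x'' u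
  proof -
    have "smooth_on (J \<times> chart_img c) (\<lambda>p. wedge12 (a c p) (curl (e c) p) x x' x'')"
      unfolding wedge12_def using one_form_familyD(1)[OF a c] one_form_familyD(1)[OF e c]
      by (intro smooth_on_add[OF S] smooth_on_diff[OF S] smooth_on_mult[OF S] smooth_curl[OF S]) auto
    from smooth_slice(2)[OF this t z] show ?thesis .
  qed
  have sum3: "(\<Sum>i\<le>3. f i) = f 0 + f 1 + f 2 + f (3::nat)" for f :: "nat \<Rightarrow> real"
    by (simp add: numeral_3_eq_3 numeral_2_eq_2)
  show ?thesis
    using wedge12_curl_derivative[OF S one_form_familyD(1)[OF a c] one_form_familyD(1)[OF e c] p,
        where x="v 0" and y="v 1" and z="v 2" and w="v 3"]
    unfolding ext_d_def wedge_curl_def sum3 sl by (simp add: numeral_3_eq_3 numeral_2_eq_2)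
qed

lemma exact_curl_product:
  assumes a: "one_form_family A J a" and e: "one_form_family A J e" and t: "t \<in> J"
    and eq: "\<And>c z v. c \<in> A \<Longrightarrow> z \<in> chart_img c \<Longrightarrow>
      \<omega> c z v = wedge22 (curl (a c) (t, z)) (curl (e c) (t, z)) (v 0) (v 1) (v 2) (v 3)"
  shows "exact_form A 4 \<omega>"
  unfolding exact_form_def form_eq_def
proof (intro exI conjI ballI allI)
  show "4 = Suc 3" by simp
  show "diff_form A 3 (wedge_curl a e t)" by (rule diff_form_wedge_curl[OF a e t])
  show "\<omega> c z v = ext_d 3 (wedge_curl a e t) c z v" if "c \<in> A" "z \<in> chart_img c" for c z v
    using that ext_d_wedge_curl[OF a e t] eq by simp
qed

lemma exact_form_linear_combination:
  assumes "exact_form A k \<omega>" "exact_form A k \<eta>"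
    and eq: "\<And>c z v. c \<in> A \<Longrightarrow> z \<in> chart_img c \<Longrightarrow> \<theta> c z v = r * \<omega> c z v + s * \<eta> c z v"
  shows "exact_form A k \<theta>"
proof -
  obtain j \<mu> \<nu> where k: "k = Suc j" and \<mu>: "diff_form A j \<mu>" "form_eq A \<omega> (ext_d j \<mu>)"
    and \<nu>: "diff_form A j \<nu>" "form_eq A \<eta> (ext_d j \<nu>)"
    using assms(1,2) by (auto simp: exact_form_def)
  define \<kappa> :: "('a, 'e) form" where "\<kappa> = (\<lambda>c z v. r * \<mu> c z v + s * \<nu> c z v)"
  have "diff_form A j \<kappa>"
    unfolding diff_form_def
  proof (intro conjI ballI allI)
    fix c z assume c: "c \<in> A" and z: "z \<in> chart_img c"
    have am: "alternating_multilinear j (\<mu> c z)" "alternating_multilinear j (\<nu> c z)"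
      using \<mu>(1) \<nu>(1) c z by (auto simp: diff_form_def)
    have "linear (\<lambda>x. r * \<mu> c z (v(i := x)) + s * \<nu> c z (v(i := x)))" if "i < j" for v i
    proof -
      have l: "linear (\<lambda>x. \<mu> c z (v(i := x)))" "linear (\<lambda>x. \<nu> c z (v(i := x)))"
        using am that by (auto simp: alternating_multilinear_def)
      show ?thesis
        using linear_add[OF l(1)] linear_add[OF l(2)] linear_scale[OF l(1)] linear_scale[OF l(2)]
        by (auto intro!: linearI simp: algebra_simps)
    qed
    moreover have "r * \<mu> c z v + s * \<nu> c z v = r * \<mu> c z w + s * \<nu> c z w" if "\<forall>i<j. v i = w i" for v w
    proof -
      have "\<mu> c z v = \<mu> c z w" "\<nu> c z v = \<nu> c z w"
        using am[unfolded alternating_multilinear_def, THEN conjunct1] that by simp_all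
      then show ?thesis by simp
    qed
    moreover have "r * \<mu> c z v + s * \<nu> c z v = 0" if "i < j" "i' < j" "i \<noteq> i' \<and> v i = v i'" for v i i'
    proof -
      have "\<mu> c z v = 0" "\<nu> c z v = 0"
        using am[unfolded alternating_multilinear_def, THEN conjunct2, THEN conjunct2, rule_format, of i i' v] that
        by simp_all
      then show ?thesis by simp
    qed
    ultimately show "alternating_multilinear j (\<kappa> c z)"
      unfolding alternating_multilinear_def \<kappa>_def by simp
  next
    fix c v assume c: "c \<in> A"
    note S = chart_facts(1)[OF c]
    show "smooth_on (chart_img c) (\<lambda>z. \<kappa> c z v)"
      unfolding \<kappa>_def using \<mu>(1) \<nu>(1) c
      by (intro smooth_on_add[OF S] smooth_on_mult[OF S] smooth_on_const) (auto simp: diff_form_def)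
  next
    fix c c' z and v :: "nat \<Rightarrow> 'e" assume c: "c \<in> A" "c' \<in> A" "z \<in> chart_overlap c c'"
    let ?w = "\<lambda>i. frechet_derivative (transition c c') (at z) (v i)"
    have "\<mu> c z v = \<mu> c' (transition c c' z) ?w" "\<nu> c z v = \<nu> c' (transition c c' z) ?w"
      using \<mu>(1) \<nu>(1) c by (simp_all add: diff_form_def)
    then show "\<kappa> c z v = \<kappa> c' (transition c c' z) ?w"
      by (simp only: \<kappa>_def)
  qed
  moreover have "form_eq A \<theta> (ext_d j \<kappa>)"
    unfolding form_eq_def
  proof (intro ballI allI)
    fix c z v assume c: "c \<in> A" and z: "z \<in> chart_img c"
    have "frechet_derivative (\<lambda>y. \<kappa> c y w) (at z) u
      = r * frechet_derivative (\<lambda>y. \<mu> c y w) (at z) u + s * frechet_derivative (\<lambda>y. \<nu> c y w) (at z) u" for w u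
    proof -
      have "(\<lambda>y. \<mu> c y w) differentiable (at z)" "(\<lambda>y. \<nu> c y w) differentiable (at z)"
        by (rule smooth_on_differentiable[OF _ z],
            rule \<mu>(1)[unfolded diff_form_def, THEN conjunct2, THEN conjunct1, rule_format, OF c]
              \<nu>(1)[unfolded diff_form_def, THEN conjunct2, THEN conjunct1, rule_format, OF c])+
      then show ?thesis by (simp add: \<kappa>_def frechet_derivative_add frechet_derivative_mult differentiable_mult)
    qed
    then have "ext_d j \<kappa> c z v = r * ext_d j \<mu> c z v + s * ext_d j \<nu> c z v"
      by (simp add: ext_d_def sum.distrib sum_distrib_left algebra_simps)
    then show "\<theta> c z v = ext_d j \<kappa> c z v"
      using eq[OF c z] \<mu>(2) \<nu>(2) c z by (simp add: form_eq_def)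
  qed
  ultimately show ?thesis unfolding exact_form_def k by blast
qed

lemma deRham_class_exact:
  assumes "exact_form A k \<omega>"
  shows "deRham_class A k \<omega> = deRham_class A k zero_form"
proof -
  have "exact_form A k (form_diff \<omega> \<eta>) \<longleftrightarrow> exact_form A k (form_diff zero_form \<eta>)" for \<eta>
    using exact_form_linear_combination[OF _ assms, of "form_diff \<omega> \<eta>" "form_diff zero_form \<eta>" 1 "-1"]
      exact_form_linear_combination[OF _ assms, of "form_diff zero_form \<eta>" "form_diff \<omega> \<eta>" 1 1]
    by (auto simp: form_diff_def zero_form_def)
  then show ?thesis by (simp add: deRham_class_def)
qed

section \<open>From forms to coefficients\<close>

lemma form_family_1_eval:
  assumes "form_family A J 1 \<omega>" "c \<in> A" "z \<in> chart_img c" "t \<in> J"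
  shows "\<omega> t c z v = coeff1 \<omega> c (t, z) (v 0)"
proof -
  have "alternating_multilinear 1 (\<omega> t c z)" using assms by (auto simp: form_family_def diff_form_def)
  from this[unfolded alternating_multilinear_def, THEN conjunct1, rule_format, of v "\<lambda>_. v 0"]
  have "\<omega> t c z v = \<omega> t c z (\<lambda>_. v 0)" by fastforce
  then show ?thesis unfolding coeff1_def fst_conv snd_conv .
qed

lemma one_form_family_coeff1:
  assumes w: "form_family A J 1 \<omega>"
  shows "one_form_family A J (coeff1 \<omega>)"
  unfolding one_form_family_def
proof (intro conjI ballI allI)
  fix c x assume "c \<in> A"
  then show "smooth_on (J \<times> chart_img c) (\<lambda>p. coeff1 \<omega> c p x)"
    using w by (simp add: form_family_def coeff1_def)
next
  fix c p assume c: "c \<in> A" and p: "p \<in> J \<times> chart_img c"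
  then obtain t z where tz: "p = (t, z)" "t \<in> J" "z \<in> chart_img c" by auto
  have "alternating_multilinear 1 (\<omega> t c z)" using w c tz by (auto simp: form_family_def diff_form_def)
  from this[unfolded alternating_multilinear_def, THEN conjunct2, THEN conjunct1, rule_format, of 0 "\<lambda>_. 0"]
  have "linear (\<lambda>x. \<omega> t c z ((\<lambda>_. 0)(0 := x)))" by simp
  moreover have "(\<lambda>x. \<omega> t c z ((\<lambda>_. 0)(0 := x))) = coeff1 \<omega> c p"
    by (rule ext) (simp only: form_family_1_eval[OF w c tz(3,2)] tz(1) fun_upd_same)
  ultimately show "linear (coeff1 \<omega> c p)" by (simp only:)
next
  fix c c' t z x assume c: "c \<in> A" "c' \<in> A" and t: "t \<in> J" and z: "z \<in> chart_overlap c c'"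
  have "diff_form A 1 (\<omega> t)" using w t by (simp add: form_family_def)
  from this[unfolded diff_form_def, THEN conjunct2, THEN conjunct2, rule_format, OF c z, of "\<lambda>_. x"]
  show "coeff1 \<omega> c (t, z) x = coeff1 \<omega> c' (t, transition c c' z) (frechet_derivative (transition c c') (at z) x)"
    by (simp only: coeff1_def fst_conv snd_conv)
qed

lemma ext_d_coeff1:
  assumes w: "form_family A J 1 \<omega>" and c: "c \<in> A" "z \<in> chart_img c" "t \<in> J"
  shows "ext_d 1 (\<omega> t) c z v = curl (coeff1 \<omega> c) (t, z) (v 0) (v 1)"
proof -
  note o = one_form_familyD[OF one_form_family_coeff1[OF w] c(1)]
  have "frechet_derivative (\<lambda>y. \<omega> t c y s) (at z) u = grad (\<lambda>p. coeff1 \<omega> c p (s 0)) (t, z) u" for s u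
  proof -
    have "frechet_derivative (\<lambda>y. \<omega> t c y s) (at z) = frechet_derivative (\<lambda>y. coeff1 \<omega> c (t, y) (s 0)) (at z)"
      by (rule frechet_derivative_cong_open[OF chart_facts(1)[OF c(1)] c(2)])
        (rule form_family_1_eval[OF w c(1) _ c(3)])
    then show ?thesis using smooth_slice(2)[OF o(1)[rule_format] c(3,2)] by simp
  qed
  then show ?thesis unfolding ext_d_def by (simp add: curl_def)
qed

lemma form_dot_coeff1:
  assumes w: "form_family A J 1 \<omega>" and c: "c \<in> A" "z \<in> chart_img c" "t \<in> J"
  shows "form_dot \<omega> t c z v = tdot (coeff1 \<omega> c) (t, z) (v 0)"
proof -
  note o = one_form_familyD[OF one_form_family_coeff1[OF w] c(1)]
  have "form_dot \<omega> t c z v = deriv (\<lambda>s. coeff1 \<omega> c (s, z) (v 0)) t"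
    unfolding form_dot_def
    by (rule deriv_cong_ev)
      (use eventually_nhds_in_open[OF J c(3)] form_family_1_eval[OF w c(1,2)] in \<open>auto elim: eventually_mono\<close>)
  also have "\<dots> = tdot (coeff1 \<omega> c) (t, z) (v 0)"
    unfolding tdot_def by (rule smooth_slice(3)[OF o(1)[rule_format] c(3,2)])
  finally show ?thesis .
qed

lemma TGV_form_coeff1:
  assumes w: "form_family A J 1 \<beta>" and c: "c \<in> A" "z \<in> chart_img c" "t \<in> J"
  shows "TGV_form \<beta> t c z v = tgv_coeff_form (coeff1 \<beta>) t c z v"
proof -
  have "wedge 1 2 (\<beta> t) (ext_d 1 (\<beta> t)) c z v
    = wedge12 (coeff1 \<beta> c (t, z)) (curl (coeff1 \<beta> c) (t, z)) (v 0) (v 1) (v 2)" for v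
    by (rule wedge_1_2) (rule form_family_1_eval[OF w c] ext_d_coeff1[OF w c] curl_antisym)+
  then show ?thesis
    unfolding TGV_form_def tgv_coeff_form_def tgv_def
    by (intro wedge_1_3 form_dot_coeff1[OF w c] curl_antisym)
qed

lemma curl_coeff1_eq:
  assumes "form_family A J 1 \<alpha>" "form_family A J 1 \<beta>" "form_family A J 1 \<gamma>"
    and c: "c \<in> A" "z \<in> chart_img c" "t \<in> J"
    and "form_eq A (ext_d 1 (\<gamma> t)) (wedge 1 1 (\<alpha> t) (\<beta> t))"
  shows "curl (coeff1 \<gamma> c) (t, z) x y = wedge11 (coeff1 \<alpha> c (t, z)) (coeff1 \<beta> c (t, z)) x y"
proof -
  let ?v = "\<lambda>i::nat. if i = 0 then x else y"
  have "ext_d 1 (\<gamma> t) c z ?v = wedge 1 1 (\<alpha> t) (\<beta> t) c z ?v"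
    using assms by (simp add: form_eq_def)
  also have "\<dots> = wedge11 (coeff1 \<alpha> c (t, z)) (coeff1 \<beta> c (t, z)) (?v 0) (?v 1)"
    by (rule wedge_1_1) (rule form_family_1_eval[OF assms(1) c] form_family_1_eval[OF assms(2) c])+
  finally show ?thesis using ext_d_coeff1[OF assms(3) c, of ?v] by simp
qed

lemma structure_pair_coeff1:
  assumes "defining_family A J F \<alpha>" "structure_beta A J \<alpha> \<beta>"
  shows "structure_pair A J (coeff1 \<alpha>) (coeff1 \<beta>)"
proof -
  have ff: "form_family A J 1 \<alpha>" "form_family A J 1 \<beta>"
    using assms by (auto simp: defining_family_def structure_beta_def)
  have "\<exists>u. coeff1 \<alpha> c (t, z) u \<noteq> 0" if c: "c \<in> A" "z \<in> chart_img c" "t \<in> J" for c t z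
  proof -
    obtain v where "\<alpha> t c z v \<noteq> 0"
      using assms(1) c unfolding defining_family_def defining_form_def by blast
    then show ?thesis using form_family_1_eval[OF ff(1) c] by metis
  qed
  moreover have "curl (coeff1 \<alpha> c) (t, z) x y = wedge11 (coeff1 \<alpha> c (t, z)) (coeff1 \<beta> c (t, z)) x y"
    if c: "c \<in> A" "z \<in> chart_img c" "t \<in> J" for c t z x y
    by (rule curl_coeff1_eq[OF ff ff(1) c]) (use assms(2) c in \<open>simp add: structure_beta_def\<close>)
  ultimately show ?thesis
    unfolding structure_pair_def using one_form_family_coeff1 ff by auto
qed

section \<open>Independence of the choice of the defining form and of \<open>\<beta>\<close>\<close>

text \<open>The quotient of two parallel 1-forms, given in each chart by a global formula, the quotient of inner
  products of coefficient vectors. This makes smoothness evident, while compatibility with changes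
  of charts follows because the quotient is determined by the two forms.\<close>

lemma form_ratio:
  assumes a: "one_form_family A J a" and w: "one_form_family A J w"
    and nz: "\<And>c p. c \<in> A \<Longrightarrow> p \<in> J \<times> chart_img c \<Longrightarrow> \<exists>u. a c p u \<noteq> 0"
    and ratio: "\<And>c p. c \<in> A \<Longrightarrow> p \<in> J \<times> chart_img c \<Longrightarrow> \<exists>k. \<forall>x. w c p x = k * a c p x"
  obtains f where "scalar_family A J f"
    "\<And>c p x. c \<in> A \<Longrightarrow> p \<in> J \<times> chart_img c \<Longrightarrow> w c p x = f c p * a c p x"
proof
  define f where "f = (\<lambda>c p. (\<Sum>b\<in>Basis. w c p b * a c p b) / (\<Sum>b\<in>Basis. a c p b * a c p b))"
  have pos: "(\<Sum>b\<in>Basis. a c p b * a c p b) \<noteq> 0" if c: "c \<in> A" and p: "p \<in> J \<times> chart_img c" for c p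
  proof
    assume "(\<Sum>b\<in>Basis. a c p b * a c p b) = 0"
    then have "\<forall>b\<in>Basis. a c p b = 0"
      by (subst (asm) sum_nonneg_eq_0_iff) auto
    then have "a c p u = 0" for u
      using linear_basis_expansion[OF one_form_familyD(2)[OF a c p], of u] by simp
    then show False using nz[OF c p] by blast
  qed
  show eq: "w c p x = f c p * a c p x" if c: "c \<in> A" and p: "p \<in> J \<times> chart_img c" for c p x
  proof -
    obtain k where k: "\<forall>x. w c p x = k * a c p x" using ratio[OF c p] by blast
    then have "(\<Sum>b\<in>Basis. w c p b * a c p b) = k * (\<Sum>b\<in>Basis. a c p b * a c p b)"
      by (simp add: sum_distrib_left mult.assoc)
    then show ?thesis using k pos[OF c p] by (simp add: f_def)
  qed
  show "scalar_family A J f"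
    unfolding scalar_family_def
  proof (intro conjI ballI)
    fix c assume c: "c \<in> A"
    note S = open_chart_domain[OF c]
    show "smooth_on (J \<times> chart_img c) (f c)"
      unfolding f_def using pos[OF c] one_form_familyD(1)[OF a c] one_form_familyD(1)[OF w c]
      by (intro smooth_on_divide[OF S] smooth_on_sum[OF S] smooth_on_mult[OF S]) auto
  next
    fix c c' t z assume c: "c \<in> A" "c' \<in> A" and t: "t \<in> J" and z: "z \<in> chart_overlap c c'"
    have p: "(t, z) \<in> J \<times> chart_img c" "(t, transition c c' z) \<in> J \<times> chart_img c'"
      using t z transition_in[OF c(1) z] subsetD[OF overlap_subset z] by auto
    obtain u where u: "a c (t, z) u \<noteq> 0" using nz[OF c(1) p(1)] by blast
    have "f c (t, z) * a c (t, z) u = w c (t, z) u"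
      by (rule eq[OF c(1) p(1), symmetric])
    also have "\<dots> = w c' (t, transition c c' z) (frechet_derivative (transition c c') (at z) u)"
      by (rule one_form_familyD(3)[OF w c t z])
    also have "\<dots> = f c' (t, transition c c' z) * a c' (t, transition c c' z) (frechet_derivative (transition c c') (at z) u)"
      by (rule eq[OF c(2) p(2)])
    also have "\<dots> = f c' (t, transition c c' z) * a c (t, z) u"
      by (simp only: one_form_familyD(3)[OF a c t z, of u])
    finally have "f c (t, z) * a c (t, z) u = f c' (t, transition c c' z) * a c (t, z) u" .
    then show "f c (t, z) = f c' (t, transition c c' z)" using u by simp
  qed
qed

text \<open>In a foliated chart of the foliation at time \<open>t\<close> both forms have the kernel and the positive side of
  the transverse coordinate. The factor is carried over to the chart \<open>c\<close>.\<close>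

lemma defining_forms_proportional:
  assumes fol: "smooth_foliation_family X A J F"
    and d: "defining_family A J F \<alpha>" "defining_family A J F \<alpha>'"
    and c: "c \<in> A" and p: "p \<in> J \<times> chart_img c"
  obtains k where "k > 0" "\<And>x. coeff1 \<alpha>' c p x = k * coeff1 \<alpha> c p x"
proof -
  obtain t z where tz: "p = (t, z)" "t \<in> J" "z \<in> chart_img c" using p by auto
  have fo: "oriented_foliation X A (F t)" using fol tz by (simp add: smooth_foliation_family_def)
  obtain m where m: "m \<in> fst c" "z = snd c m" using tz(3) by (auto simp: chart_img_def)
  have "m \<in> topspace X" using openin_subset[OF chart_facts(2)[OF c]] m by blast
  then obtain c' where c': "c' \<in> F t" "m \<in> fst c'"
    using fo unfolding oriented_foliation_def by blast
  have cA: "c' \<in> A" using fo c'(1) by (auto simp: oriented_foliation_def)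
  have z: "z \<in> chart_overlap c c'" using m c' by (auto simp: chart_overlap_def)
  let ?y = "transition c c' z"
  have y: "?y \<in> chart_img c'" by (rule transition_in[OF c z])
  have ff: "form_family A J 1 \<alpha>" "form_family A J 1 \<alpha>'"
    using d by (auto simp: defining_family_def)
  note o = one_form_family_coeff1[OF ff(1)] one_form_family_coeff1[OF ff(2)]
  have p': "(t, ?y) \<in> J \<times> chart_img c'" using tz y by simp
  have kernel: "(coeff1 \<omega> c' (t, ?y) w = 0 \<longleftrightarrow> transverse_coord w = 0)
      \<and> (transverse_coord w > 0 \<longrightarrow> coeff1 \<omega> c' (t, ?y) w > 0)" if "defining_family A J F \<omega>" for \<omega> w
    using that tz(2) c'(1) y by (simp add: defining_family_def defining_form_def coeff1_def)
  obtain k where k: "k > 0" "\<And>w. coeff1 \<alpha>' c' (t, ?y) w = k * coeff1 \<alpha> c' (t, ?y) w"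
    by (rule transverse_kernel_proportional[OF one_form_familyD(2)[OF o(1) cA p'] one_form_familyD(2)[OF o(2) cA p']])
      (use kernel[OF d(1)] kernel[OF d(2)] in blast)+
  have "coeff1 \<alpha>' c p x = k * coeff1 \<alpha> c p x" for x
    unfolding tz(1) one_form_familyD(3)[OF o(1) c cA tz(2) z, of x] one_form_familyD(3)[OF o(2) c cA tz(2) z, of x]
    by (rule k(2))
  with k(1) show ?thesis using that by blast
qed

text \<open>Write \<open>a' = f a\<close> and \<open>h = - ln f\<close>, so that \<open>df = - f dh\<close>. Then \<open>da' = df \<and> a + f da = a' \<and> (b + dh)\<close>.
  Comparison with \<open>da' = a' \<and> b'\<close> shows that \<open>b' - b - dh\<close> is parallel to \<open>a'\<close>.\<close>

lemma structure_pair_rescale: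
  assumes s: "structure_pair A J a b" and s': "structure_pair A J a' b'"
    and ratio: "\<And>c p. c \<in> A \<Longrightarrow> p \<in> J \<times> chart_img c \<Longrightarrow> \<exists>k>0. \<forall>x. a' c p x = k * a c p x"
  obtains h g where "scalar_family A J h" "scalar_family A J g"
    "\<And>c p x. c \<in> A \<Longrightarrow> p \<in> J \<times> chart_img c \<Longrightarrow> b' c p x = b c p x + grad (h c) p x + g c p * a' c p x"
proof -
  have fam: "one_form_family A J a" "one_form_family A J b" "one_form_family A J a'" "one_form_family A J b'"
    and nz: "\<And>c p. c \<in> A \<Longrightarrow> p \<in> J \<times> chart_img c \<Longrightarrow> \<exists>u. a c p u \<noteq> 0"
    and nz': "\<And>c p. c \<in> A \<Longrightarrow> p \<in> J \<times> chart_img c \<Longrightarrow> \<exists>u. a' c p u \<noteq> 0"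
    and da: "\<And>c p x y. c \<in> A \<Longrightarrow> p \<in> J \<times> chart_img c \<Longrightarrow> curl (a c) p x y = wedge11 (a c p) (b c p) x y"
    and da': "\<And>c p x y. c \<in> A \<Longrightarrow> p \<in> J \<times> chart_img c \<Longrightarrow> curl (a' c) p x y = wedge11 (a' c p) (b' c p) x y"
    by (fact structure_pairD[OF s] structure_pairD[OF s'])+
  have ratio': "\<exists>k. \<forall>x. a' c p x = k * a c p x" if "c \<in> A" "p \<in> J \<times> chart_img c" for c p
    using ratio[OF that] by blast
  obtain f where f: "scalar_family A J f"
    "\<And>c p x. c \<in> A \<Longrightarrow> p \<in> J \<times> chart_img c \<Longrightarrow> a' c p x = f c p * a c p x"
    using form_ratio[OF fam(1,3) nz ratio'] by blast
  have fpos: "f c p > 0" if c: "c \<in> A" and p: "p \<in> J \<times> chart_img c" for c p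
  proof -
    obtain k where k: "k > 0" "\<And>x. a' c p x = k * a c p x" using ratio[OF c p] by blast
    obtain u where "a c p u \<noteq> 0" using nz[OF c p] by blast
    then have "f c p = k" using k(2)[of u] f(2)[OF c p, of u] by simp
    then show ?thesis using k(1) by simp
  qed
  define h where "h = (\<lambda>c p. - ln (f c p))"
  have h: "scalar_family A J h"
    unfolding scalar_family_def h_def
  proof (intro conjI ballI)
    fix c assume c: "c \<in> A"
    note S = open_chart_domain[OF c]
    have "smooth_on (J \<times> chart_img c) (\<lambda>p. 0 - ln (f c p))"
      by (rule smooth_on_diff[OF S smooth_on_const smooth_on_ln[OF S scalar_familyD(1)[OF f(1) c] fpos[OF c]]])
    then show "smooth_on (J \<times> chart_img c) (\<lambda>p. - ln (f c p))" by simp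
  qed (use scalar_familyD(2)[OF f(1)] in auto)
  have gradh: "f c p * grad (h c) p x = - grad (f c) p x" if c: "c \<in> A" and p: "p \<in> J \<times> chart_img c" for c p x
  proof -
    have "((\<lambda>s. - ln s) has_real_derivative - inverse (f c p)) (at (f c p))"
      by (rule DERIV_minus[OF DERIV_ln[OF fpos[OF c p]]])
    from frechet_derivative_comp_real(2)[OF smooth_on_differentiable[OF scalar_familyD(1)[OF f(1) c] p] this]
    show ?thesis using fpos[OF c p] by (simp add: grad_def h_def)
  qed
  define w where "w = (\<lambda>c p x. (b' c p x - b c p x) - grad (h c) p x)"
  have w: "one_form_family A J w"
    unfolding w_def
    by (intro one_form_family_diff fam one_form_family_grad[OF h])
  have parallel: "\<exists>k. \<forall>x. w c p x = k * a' c p x" if c: "c \<in> A" and p: "p \<in> J \<times> chart_img c" for c p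
  proof -
    have "curl (a' c) p = curl (\<lambda>q x. f c q * a c q x) p"
      by (rule curl_cong[OF open_chart_domain[OF c] p f(2)[OF c]])
    then have "wedge11 (a' c p) (b' c p) x y = wedge11 (grad (f c) p) (a c p) x y + f c p * wedge11 (a c p) (b c p) x y" for x y
      unfolding da'[OF c p, symmetric] da[OF c p, symmetric]
      by (simp only: curl_rules(3)[OF open_chart_domain[OF c] one_form_familyD(1)[OF fam(1) c]
            one_form_familyD(1)[OF fam(1) c] scalar_familyD(1)[OF f(1) c] p])
    note dd = this[unfolded wedge11_def f(2)[OF c p]]
    have "a' c p x * w c p y = a' c p y * w c p x" for x y
      unfolding w_def f(2)[OF c p] using dd[of x y] gradh[OF c p, of x] gradh[OF c p, of y]
      by algebra
    moreover obtain u where "a' c p u \<noteq> 0" using nz'[OF c p] by blast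
    ultimately have "w c p x = w c p u / a' c p u * a' c p x" for x
      by (simp add: field_simps)
    then show ?thesis by blast
  qed
  obtain g where g: "scalar_family A J g"
    "\<And>c p x. c \<in> A \<Longrightarrow> p \<in> J \<times> chart_img c \<Longrightarrow> w c p x = g c p * a' c p x"
    using form_ratio[OF fam(3) w nz' parallel] by blast
  show ?thesis
    by (rule that[OF h g(1)]) (use g(2) in \<open>simp add: w_def algebra_simps\<close>)
qed

text \<open>The passage from \<open>b\<close> to \<open>b'\<close> is factored through \<open>m = b + dh = b' - g a'\<close>, which satisfies
  \<open>da' = a' \<and> m\<close>.\<close>

lemma tgv_difference_exact:
  assumes s: "structure_pair A J a b" and s': "structure_pair A J a' b'"
    and ratio: "\<And>c p. c \<in> A \<Longrightarrow> p \<in> J \<times> chart_img c \<Longrightarrow> \<exists>k>0. \<forall>x. a' c p x = k * a c p x"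
    and t: "t \<in> J"
  shows "exact_form A 4 (form_diff (tgv_coeff_form b' t) (tgv_coeff_form b t))"
proof -
  have fam: "one_form_family A J a" "one_form_family A J b" "one_form_family A J a'" "one_form_family A J b'"
    and nz: "\<And>c p. c \<in> A \<Longrightarrow> p \<in> J \<times> chart_img c \<Longrightarrow> \<exists>u. a c p u \<noteq> 0"
    and nz': "\<And>c p. c \<in> A \<Longrightarrow> p \<in> J \<times> chart_img c \<Longrightarrow> \<exists>u. a' c p u \<noteq> 0"
    and da: "\<And>c p x y. c \<in> A \<Longrightarrow> p \<in> J \<times> chart_img c \<Longrightarrow> curl (a c) p x y = wedge11 (a c p) (b c p) x y"
    and da': "\<And>c p x y. c \<in> A \<Longrightarrow> p \<in> J \<times> chart_img c \<Longrightarrow> curl (a' c) p x y = wedge11 (a' c p) (b' c p) x y"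
    by (fact structure_pairD[OF s] structure_pairD[OF s'])+
  obtain h g where h: "scalar_family A J h" and g: "scalar_family A J g" and
    b': "\<And>c p x. c \<in> A \<Longrightarrow> p \<in> J \<times> chart_img c \<Longrightarrow> b' c p x = b c p x + grad (h c) p x + g c p * a' c p x"
    using structure_pair_rescale[OF s s' ratio] by blast
  define m where "m = (\<lambda>c p x. b' c p x - g c p * a' c p x)"
  have m: "one_form_family A J m"
    unfolding m_def by (intro one_form_family_diff one_form_family_mult fam g)
  define P1 where "P1 = (\<lambda>c p x. tder (h c) p * m c p x - h c p * tdot (b c) p x)"
  define P2 where "P2 = (\<lambda>c p x. g c p * m c p x)"
  define P3 where "P3 = (\<lambda>c p x. (g c p * g c p) * tdot (a' c) p x)"
  note tdots = one_form_family_tdot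
  have P: "one_form_family A J P1" "one_form_family A J P2" "one_form_family A J P3"
    unfolding P1_def P2_def P3_def
    by (intro one_form_family_diff one_form_family_mult scalar_family_mult
        scalar_family_tder tdots fam m g h)+
  define E where "E = (\<lambda>P (e :: ('a, 'e) chart \<Rightarrow> real \<times> 'e \<Rightarrow> 'e \<Rightarrow> real) (c :: ('a, 'e) chart) z (v :: nat \<Rightarrow> 'e).
    wedge22 (curl (P c) (t, z)) (curl (e c) (t, z)) (v 0) (v 1) (v 2) (v 3))"
  have E: "exact_form A 4 (E P e)" if "one_form_family A J P" "one_form_family A J e" for P e
    by (rule exact_curl_product[OF that t]) (simp add: E_def)
  have diff: "form_diff (tgv_coeff_form b' t) (tgv_coeff_form b t) c z v
      = 1 * E P1 b c z v + 1 * (1 * E P2 (\<lambda>c. tdot (a' c)) c z v + (- 1/2) * E P3 a' c z v)"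
    if c: "c \<in> A" and z: "z \<in> chart_img c" for c z v
  proof -
    have p: "(t, z) \<in> J \<times> chart_img c" using t z by simp
    note S = open_chart_domain[OF c]
    note sm = one_form_familyD(1)[OF _ c] and sc = scalar_familyD(1)[OF _ c]
    obtain u' where u': "a' c (t, z) u' \<noteq> 0" using nz'[OF c p] by blast
    have sq: "wedge22 (curl (b c) q) (curl (b c) q) x y z w = 0" if q: "q \<in> J \<times> chart_img c" for q x y z w
    proof -
      obtain u where u: "a c q u \<noteq> 0" using nz[OF c q] by blast
      show ?thesis by (rule curl_square_zero[OF S sm[OF fam(1)] sm[OF fam(2)] q da[OF c] u])
    qed
    have mb: "m c q x = b c q x + grad (h c) q x" "b' c q x = m c q x + g c q * a' c q x"
      if "q \<in> J \<times> chart_img c" for q x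
      using b'[OF c that] by (simp_all add: m_def)
    have dm: "curl (a' c) q x y = wedge11 (a' c q) (m c q) x y" if "q \<in> J \<times> chart_img c" for q x y
      using da'[OF c that] by (simp add: m_def wedge11_def algebra_simps)
    have 1: "tgv (m c) (t, z) x y z' w - tgv (b c) (t, z) x y z' w
      = wedge22 (curl (P1 c) (t, z)) (curl (b c) (t, z)) x y z' w" for x y z' w
      unfolding P1_def by (rule tgv_add_grad[OF S sm[OF fam(2)] sc[OF h] p sq mb(1)])
    have 2: "tgv (b' c) (t, z) x y z' w - tgv (m c) (t, z) x y z' w
      = wedge22 (curl (P2 c) (t, z)) (curl (tdot (a' c)) (t, z)) x y z' w
        - 1/2 * wedge22 (curl (P3 c) (t, z)) (curl (a' c) (t, z)) x y z' w" for x y z' w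
      unfolding P2_def P3_def
      by (rule tgv_add_multiple[OF S sm[OF fam(3)] sm[OF m] sc[OF g] p dm mb(2) u'])
    have "r1 - r2 = s1 \<Longrightarrow> r3 - r1 = s2 - 1/2 * s3 \<Longrightarrow> r3 - r2 = 1 * s1 + 1 * (1 * s2 + (- 1/2) * s3)"
      for r1 r2 r3 s1 s2 s3 :: real by simp
    from this[OF 1 2] show ?thesis
      unfolding form_diff_def tgv_coeff_form_def E_def .
  qed
  show ?thesis
    by (rule exact_form_linear_combination[OF E[OF P(1) fam(2)]
          exact_form_linear_combination[OF E[OF P(2) tdots[OF fam(3)]] E[OF P(3) fam(3)] refl] diff])
qed

section \<open>Vanishing of the class\<close>

lemma exact_form_zero:
  assumes "t \<in> J" "\<And>c z v. c \<in> A \<Longrightarrow> z \<in> chart_img c \<Longrightarrow> \<omega> c z v = 0"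
  shows "exact_form A 4 \<omega>"
proof -
  have 0: "one_form_family A J (\<lambda>c p x. 0)"
    by (simp add: one_form_family_def smooth_on_const linear_zero)
  show ?thesis
    by (rule exact_curl_product[OF 0 0 assms(1)]) (simp add: assms(2) wedge22_def curl_def grad_def)
qed

lemma closed_1family_curl:
  assumes w: "form_family A J 1 \<omega>" and cl: "closed_1family A J \<omega>"
    and c: "c \<in> A" and p: "p \<in> J \<times> chart_img c"
  shows "curl (coeff1 \<omega> c) p x y = 0"
proof -
  obtain t z where tz: "p = (t, z)" "t \<in> J" "z \<in> chart_img c" using p by auto
  have "ext_d 1 (\<omega> t) c z (\<lambda>i. if i = 0 then x else y) = 0"
    using cl c tz by (simp add: closed_1family_def closed_form_def form_eq_def zero_form_def)
  then show ?thesis using ext_d_coeff1[OF w c tz(3,2)] tz(1) by simp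
qed

lemma vanishes_imp_closed:
  assumes "vanishes A J \<omega>"
  shows "closed_1family A J \<omega>"
  unfolding closed_1family_def closed_form_def form_eq_def
proof (intro ballI allI)
  fix t c z v assume t: "t \<in> J" and c: "c \<in> A" and z: "z \<in> chart_img c"
  have "frechet_derivative (\<lambda>y. \<omega> t c y s) (at z) = frechet_derivative (\<lambda>y. 0) (at z)" for s
    by (rule frechet_derivative_cong_open[OF chart_facts(1)[OF c] z])
      (use assms t c in \<open>simp add: vanishes_def form_eq_def zero_form_def\<close>)
  then show "ext_d 1 (\<omega> t) c z v = zero_form c z v" by (simp add: ext_d_def zero_form_def)
qed

text \<open>The pair chosen by \<open>TGV\<close> is admissible since \<open>(\<alpha>, \<beta>)\<close> is, and its form differs from that of \<open>\<beta>\<close> by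
  an exact one.\<close>

lemma TGV_eq_zero:
  assumes fol: "smooth_foliation_family X A J F"
    and d: "defining_family A J F \<alpha>" "structure_beta A J \<alpha> \<beta>"
    and ex: "exact_form A 4 (tgv_coeff_form (coeff1 \<beta>) t)" and t: "t \<in> J"
  shows "TGV A J F t = deRham_class A 4 zero_form"
proof -
  define \<beta>' where "\<beta>' = (SOME \<beta>. \<exists>\<alpha>. defining_family A J F \<alpha> \<and> structure_beta A J \<alpha> \<beta>)"
  have "\<exists>\<alpha>. defining_family A J F \<alpha> \<and> structure_beta A J \<alpha> \<beta>'"
    unfolding \<beta>'_def by (rule someI[where x = \<beta>]) (use d in blast)
  then obtain \<alpha>' where d': "defining_family A J F \<alpha>'" "structure_beta A J \<alpha>' \<beta>'" by blast
  have diff: "exact_form A 4 (form_diff (tgv_coeff_form (coeff1 \<beta>') t) (tgv_coeff_form (coeff1 \<beta>) t))"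
  proof (rule tgv_difference_exact[OF structure_pair_coeff1[OF d] structure_pair_coeff1[OF d'] _ t])
    fix c p assume cp: "c \<in> A" "p \<in> J \<times> chart_img c"
    obtain k where "k > 0" "\<And>x. coeff1 \<alpha>' c p x = k * coeff1 \<alpha> c p x"
      using defining_forms_proportional[OF fol d(1) d'(1) cp] by blast
    then show "\<exists>k>0. \<forall>x. coeff1 \<alpha>' c p x = k * coeff1 \<alpha> c p x" by blast
  qed
  have "exact_form A 4 (TGV_form \<beta>' t)"
  proof (rule exact_form_linear_combination[OF diff ex])
    fix c z v assume c: "c \<in> A" "z \<in> chart_img c"
    have "form_family A J 1 \<beta>'" using d'(2) by (simp add: structure_beta_def)
    from TGV_form_coeff1[OF this c t]
    show "TGV_form \<beta>' t c z v = 1 * form_diff (tgv_coeff_form (coeff1 \<beta>') t) (tgv_coeff_form (coeff1 \<beta>) t) c z v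
      + 1 * tgv_coeff_form (coeff1 \<beta>) t c z v"
      by (simp add: form_diff_def)
  qed
  then show ?thesis
    unfolding TGV_def \<beta>'_def[symmetric] by (rule deRham_class_exact)
qed

lemma TGV_zero_if_beta_closed:
  assumes fol: "smooth_foliation_family X A J F" and d: "defining_family A J F \<alpha>"
    and b: "structure_beta A J \<alpha> \<beta>" "closed_1family A J \<beta>" and t: "t \<in> J"
  shows "TGV A J F t = deRham_class A 4 zero_form"
proof (rule TGV_eq_zero[OF fol d b(1) exact_form_zero[OF t] t])
  fix c z v assume c: "c \<in> A" "z \<in> chart_img c"
  have "form_family A J 1 \<beta>" using b by (simp add: structure_beta_def)
  from closed_1family_curl[OF this b(2) c(1)] c(2) t
  show "tgv_coeff_form (coeff1 \<beta>) t c z v = 0"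
    by (simp add: tgv_coeff_form_def tgv_def wedge22_def)
qed

text \<open>If \<open>d\<alpha> = 0\<close>, then \<open>\<beta> = 0\<close> solves \<open>d\<alpha> = \<alpha> \<and> \<beta>\<close>.\<close>

lemma TGV_zero_if_alpha_closed:
  assumes fol: "smooth_foliation_family X A J F" and d: "defining_family A J F \<alpha>"
    and cl: "closed_1family A J \<alpha>" and t: "t \<in> J"
  shows "TGV A J F t = deRham_class A 4 zero_form"
proof (rule TGV_zero_if_beta_closed[OF fol d _ vanishes_imp_closed t])
  let ?\<beta> = "\<lambda>t. zero_form :: ('a, 'e) form"
  show "vanishes A J ?\<beta>" by (simp add: vanishes_def form_eq_def)
  have "form_family A J 1 ?\<beta>"
    by (simp add: form_family_def diff_form_def alternating_multilinear_def zero_form_def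
        smooth_on_const linear_zero)
  then show "structure_beta A J \<alpha> ?\<beta>"
    using cl by (simp add: structure_beta_def closed_1family_def closed_form_def wedge_def form_eq_def zero_form_def)
qed

lemma TGV_zero_if_gamma_closed:
  assumes fol: "smooth_foliation_family X A J F" and d: "defining_family A J F \<alpha>"
    and g: "structure_gamma A J \<alpha> \<beta> \<gamma>" "closed_1family A J \<gamma>" and t: "t \<in> J"
  shows "TGV A J F t = deRham_class A 4 zero_form"
proof -
  have b: "structure_beta A J \<alpha> \<beta>" using g by (simp add: structure_gamma_def)
  have ff: "form_family A J 1 \<alpha>" "form_family A J 1 \<beta>" "form_family A J 1 \<gamma>"
    using d b g by (auto simp: defining_family_def structure_beta_def structure_gamma_def)
  show ?thesis
  proof (rule TGV_eq_zero[OF fol d b exact_form_zero[OF t] t])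
    fix c z v assume c: "c \<in> A" "z \<in> chart_img c"
    have p: "(t, z) \<in> J \<times> chart_img c" using c t by simp
    note o = one_form_familyD(1)[OF one_form_family_coeff1 c(1)]
    have da: "curl (coeff1 \<alpha> c) q x y = wedge11 (coeff1 \<alpha> c q) (coeff1 \<beta> c q) x y"
      and db: "curl (coeff1 \<beta> c) q x y = wedge11 (coeff1 \<alpha> c q) (coeff1 \<gamma> c q) x y"
      if "q \<in> J \<times> chart_img c" for q x y
      using that curl_coeff1_eq[OF ff(1,2,1) c(1)] curl_coeff1_eq[OF ff(1,3,2) c(1)] b g(1)
      by (auto simp: structure_beta_def structure_gamma_def)
    show "tgv_coeff_form (coeff1 \<beta>) t c z v = 0"
      unfolding tgv_coeff_form_def
      by (rule tgv_gamma_closed[OF open_chart_domain[OF c(1)] o[OF ff(1)] o[OF ff(2)] o[OF ff(3)] p da db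
            closed_1family_curl[OF ff(3) g(2) c(1) p]])
  qed
qed

text \<open>The primitive of \<open>\<partial>\<^sub>t\<beta> \<and> \<beta> \<and> d\<beta>\<close> is \<open>\<partial>\<^sub>t\<alpha> \<and> d\<gamma>\<close>.\<close>

lemma TGV_zero_if_delta_closed:
  assumes fol: "smooth_foliation_family X A J F" and d: "defining_family A J F \<alpha>"
    and g: "structure_delta A J \<alpha> \<beta> \<gamma> \<delta>" "closed_1family A J \<delta>" and t: "t \<in> J"
  shows "TGV A J F t = deRham_class A 4 zero_form"
proof -
  have sg: "structure_gamma A J \<alpha> \<beta> \<gamma>" using g by (simp add: structure_delta_def)
  have b: "structure_beta A J \<alpha> \<beta>" using sg by (simp add: structure_gamma_def)
  have ff: "form_family A J 1 \<alpha>" "form_family A J 1 \<beta>" "form_family A J 1 \<gamma>" "form_family A J 1 \<delta>"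
    using d b g sg by (auto simp: defining_family_def structure_beta_def structure_gamma_def structure_delta_def)
  have "exact_form A 4 (tgv_coeff_form (coeff1 \<beta>) t)"
  proof (rule exact_curl_product[OF one_form_family_tdot[OF one_form_family_coeff1[OF ff(1)]]
        one_form_family_coeff1[OF ff(3)] t])
    fix c z v assume c: "c \<in> A" "z \<in> chart_img c"
    have p: "(t, z) \<in> J \<times> chart_img c" using c t by simp
    note o = one_form_familyD(1)[OF one_form_family_coeff1 c(1)]
    have da: "curl (coeff1 \<alpha> c) q x y = wedge11 (coeff1 \<alpha> c q) (coeff1 \<beta> c q) x y"
      and db: "curl (coeff1 \<beta> c) q x y = wedge11 (coeff1 \<alpha> c q) (coeff1 \<gamma> c q) x y"
      if "q \<in> J \<times> chart_img c" for q x y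
      using that curl_coeff1_eq[OF ff(1,2,1) c(1)] curl_coeff1_eq[OF ff(1,3,2) c(1)] b sg
      by (auto simp: structure_beta_def structure_gamma_def)
    have dc: "curl (coeff1 \<gamma> c) q x y
        = wedge11 (coeff1 \<beta> c q) (coeff1 \<gamma> c q) x y + wedge11 (coeff1 \<alpha> c q) (coeff1 \<delta> c q) x y"
      if q: "q \<in> J \<times> chart_img c" for q x y
    proof -
      obtain s y' where q': "q = (s, y')" "s \<in> J" "y' \<in> chart_img c" using q by auto
      let ?v = "\<lambda>i::nat. if i = 0 then x else y"
      have "ext_d 1 (\<gamma> s) c y' ?v = wedge 1 1 (\<beta> s) (\<gamma> s) c y' ?v + wedge 1 1 (\<alpha> s) (\<delta> s) c y' ?v"
        using g(1) c(1) q' by (simp add: structure_delta_def form_eq_def form_add_def)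
      moreover note ev = form_family_1_eval[OF _ c(1) q'(3,2)]
      have "wedge 1 1 (\<beta> s) (\<gamma> s) c y' ?v = wedge11 (coeff1 \<beta> c q) (coeff1 \<gamma> c q) (?v 0) (?v 1)"
        unfolding q'(1) by (rule wedge_1_1) (rule ev[OF ff(2)] ev[OF ff(3)])+
      moreover have "wedge 1 1 (\<alpha> s) (\<delta> s) c y' ?v = wedge11 (coeff1 \<alpha> c q) (coeff1 \<delta> c q) (?v 0) (?v 1)"
        unfolding q'(1) by (rule wedge_1_1) (rule ev[OF ff(1)] ev[OF ff(4)])+
      ultimately show ?thesis using ext_d_coeff1[OF ff(3) c(1) q'(3,2), of ?v] by (simp add: q'(1))
    qed
    show "tgv_coeff_form (coeff1 \<beta>) t c z v
      = wedge22 (curl (tdot (coeff1 \<alpha> c)) (t, z)) (curl (coeff1 \<gamma> c) (t, z)) (v 0) (v 1) (v 2) (v 3)"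
      unfolding tgv_coeff_form_def
      by (rule tgv_structure_delta[OF open_chart_domain[OF c(1)] o[OF ff(1)] o[OF ff(2)] o[OF ff(3)] o[OF ff(4)] p da db dc
            closed_1family_curl[OF ff(4) g(2) c(1) p]])
  qed
  then show ?thesis by (rule TGV_eq_zero[OF fol d b _ t])
qed

end

theorem theorem7:
  fixes X :: "'a topology"
    and A :: "('a, 'e::euclidean_space) chart set"
    and J :: "real set"
    and F :: "real \<Rightarrow> ('a, 'e) chart set"
  assumes "smooth_manifold X A"
    and "open J" and "is_interval J"
    and "smooth_foliation_family X A J F"
  shows
    "((\<exists>\<alpha>. defining_family A J F \<alpha> \<and>
        ((\<exists>\<beta>. structure_beta A J \<alpha> \<beta> \<and> vanishes A J \<beta>) \<or>
         (\<exists>\<beta> \<gamma>. structure_gamma A J \<alpha> \<beta> \<gamma> \<and> vanishes A J \<gamma>) \<or>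
         (\<exists>\<beta> \<gamma> \<delta>. structure_delta A J \<alpha> \<beta> \<gamma> \<delta> \<and> vanishes A J \<delta>)))
      \<longrightarrow> (\<forall>t\<in>J. TGV A J F t = deRham_class A 4 zero_form)) \<and>
     ((\<exists>\<alpha>. defining_family A J F \<alpha> \<and>
        (closed_1family A J \<alpha> \<or>
         (\<exists>\<beta>. structure_beta A J \<alpha> \<beta> \<and> closed_1family A J \<beta>) \<or>
         (\<exists>\<beta> \<gamma>. structure_gamma A J \<alpha> \<beta> \<gamma> \<and> closed_1family A J \<gamma>) \<or>
         (\<exists>\<beta> \<gamma> \<delta>. structure_delta A J \<alpha> \<beta> \<gamma> \<delta> \<and> closed_1family A J \<delta>)))
      \<longrightarrow> (\<forall>t\<in>J. TGV A J F t = deRham_class A 4 zero_form))"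
proof -
  note zero_if_closed = TGV_zero_if_alpha_closed[OF assms(1,2,4)] TGV_zero_if_beta_closed[OF assms(1,2,4)]
    TGV_zero_if_gamma_closed[OF assms(1,2,4)] TGV_zero_if_delta_closed[OF assms(1,2,4)]
  note closed = vanishes_imp_closed[OF assms(1,2)]
  show ?thesis
  proof (intro conjI impI ballI; elim exE conjE disjE)
    fix t \<alpha> \<beta> \<gamma> \<delta> assume t: "t \<in> J" and d: "defining_family A J F \<alpha>"
    show "TGV A J F t = deRham_class A 4 zero_form" if "structure_beta A J \<alpha> \<beta>" "vanishes A J \<beta>"
      by (rule zero_if_closed(2)[OF d that(1) closed[OF that(2)] t])
    show "TGV A J F t = deRham_class A 4 zero_form" if "structure_gamma A J \<alpha> \<beta> \<gamma>" "vanishes A J \<gamma>"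
      by (rule zero_if_closed(3)[OF d that(1) closed[OF that(2)] t])
    show "TGV A J F t = deRham_class A 4 zero_form" if "structure_delta A J \<alpha> \<beta> \<gamma> \<delta>" "vanishes A J \<delta>"
      by (rule zero_if_closed(4)[OF d that(1) closed[OF that(2)] t])
    show "TGV A J F t = deRham_class A 4 zero_form" if "closed_1family A J \<alpha>"
      by (rule zero_if_closed(1)[OF d that t])
    show "TGV A J F t = deRham_class A 4 zero_form" if "structure_beta A J \<alpha> \<beta>" "closed_1family A J \<beta>"
      by (rule zero_if_closed(2)[OF d that t])
    show "TGV A J F t = deRham_class A 4 zero_form" if "structure_gamma A J \<alpha> \<beta> \<gamma>" "closed_1family A J \<gamma>"
      by (rule zero_if_closed(3)[OF d that t])
    show "TGV A J F t = deRham_class A 4 zero_form" if "structure_delta A J \<alpha> \<beta> \<gamma> \<delta>" "closed_1family A J \<delta>"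
      by (rule zero_if_closed(4)[OF d that t])
  qed
qed

end
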